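(* Let $n\ge 4$, $S=\mathbb{C}[x_1,\dots,x_n]$, and let $a<b$ be positive integers. Put $n_0=b-a$, and let $q_1$ be the smallest prime factor of $n_0$. If $q_1>\max\{n,a\}$, then the ideal $I=\langle p_a,p_b\rangle$ is a prime ideal of $S$. Moreover, for every positive integer $c$ with $p_c\notin\langle p_a,p_b\rangle$, the polynomials $p_a,p_b,p_c$ form a regular sequence in $S$.
   Context: $p_a=\sum_{i=1}^n x_i^a$ denotes the power sum symmetric polynomial of degree $a$. A sequence $y_1,\dots,y_d$ in $S$ is a regular sequence if $\langle y_1,\dots,y_d\rangle\ne S$ and for each $i$ the image of $y_{i+1}$ is a nonzero divisor in $S/\langle y_1,\dots,y_i\rangle$. *)

theory Defs
  imports Complex_Main "HOL-Library.Poly_Mapping" "HOL-Computational_Algebra.Primes"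
begin

text \<open>Multivariate polynomials over the complex numbers: finitely supported maps from
  monomials (exponent vectors) to coefficients. Variables are indexed by nat;
  the ring S = C[x_1,...,x_n] is the subring of polynomials only involving x_0,...,x_(n-1).\<close>

type_synonym mpoly = "(nat \<Rightarrow>\<^sub>0 nat) \<Rightarrow>\<^sub>0 complex"

definition var :: "nat \<Rightarrow> mpoly" where
  "var i = Poly_Mapping.single (Poly_Mapping.single i 1) 1"

definition polyring :: "nat \<Rightarrow> mpoly set" where
  "polyring n = {p. \<forall>m \<in> Poly_Mapping.keys p. Poly_Mapping.keys m \<subseteq> {..<n}}"

definition psum :: "nat \<Rightarrow> nat \<Rightarrow> mpoly" where
  "psum n a = (\<Sum>i<n. var i ^ a)"

definition gen_ideal :: "nat \<Rightarrow> mpoly list \<Rightarrow> mpoly set" where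
  "gen_ideal n ys = {\<Sum>i<length ys. r i * ys ! i | r. \<forall>i<length ys. r i \<in> polyring n}"

definition prime_ideal_in :: "nat \<Rightarrow> mpoly set \<Rightarrow> bool" where
  "prime_ideal_in n I \<longleftrightarrow> I \<subseteq> polyring n \<and> I \<noteq> polyring n \<and>
     (\<forall>x\<in>polyring n. \<forall>y\<in>polyring n. x * y \<in> I \<longrightarrow> x \<in> I \<or> y \<in> I)"

definition regular_seq :: "nat \<Rightarrow> mpoly list \<Rightarrow> bool" where
  "regular_seq n ys \<longleftrightarrow> set ys \<subseteq> polyring n \<and> gen_ideal n ys \<noteq> polyring n \<and>
     (\<forall>i<length ys. \<forall>z\<in>polyring n.
         ys ! i * z \<in> gen_ideal n (take i ys) \<longrightarrow> z \<in> gen_ideal n (take i ys))"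

end

theory Submission
  imports Defs "HOL-Computational_Algebra.Polynomial"
begin

text \<open>
  Let \<open>f = p\<^sub>a\<close>, \<open>g = p\<^sub>b\<close>. Setting one variable to \<open>0\<close> turns the pair for \<open>n\<close> variables into the pair
  for \<open>n - 1\<close> variables, and since everything is homogeneous, an induction on degrees lifts
  statements from \<open>n - 1\<close> to \<open>n\<close>: each variable is regular modulo \<open>(f, g)\<close>, and so is every nonzero
  polynomial not involving two chosen variables \<open>x, y\<close>; moreover primality for \<open>4\<close> variables
  implies primality for all \<open>n \<ge> 4\<close>.

  For \<open>4\<close> variables the point is that the \<open>2 \<times> 2\<close> minors of the Jacobian matrix of \<open>(f, g)\<close> have no
  common zero on \<open>f = g = 0\<close> except the origin: at such a point the nonzero coordinates are
  \<open>(b - a)\<close>-th roots of unity up to a common factor, and a sum of at most four roots of unity of order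
  prime to \<open>6\<close> does not vanish. Let \<open>A\<close> be the quotient by \<open>(f, g)\<close>, and \<open>\<alpha> / \<beta>\<close> an idempotent fraction.
  The ideal of all \<open>\<gamma> \<in> A\<close> with \<open>\<gamma> \<alpha> / \<beta> \<in> A\<close> is stable under the derivations of \<open>A\<close> given by
  Jacobian determinants, because these kill idempotents. As \<open>A\<close> is algebraic over \<open>B = \<complex>[z, w]\<close>, the
  ideal contains a nonzero element of \<open>B\<close>; differentiating it repeatedly yields a power of a minor.
  Hence the ideal contains powers of all variables, so \<open>\<alpha> / \<beta> \<in> A\<close> by regularity, and \<open>\<alpha> / \<beta> \<in> {0, 1}\<close> by
  the grading. Consequently each element of \<open>A\<close> is nilpotent or regular. Finally \<open>A = B[x, y]\<close>, where
  \<open>x\<close> and \<open>y\<close> are simple roots of a polynomial over \<open>B\<close>, and this leaves no nilpotents.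
\<close>

section \<open>Multivariate polynomials\<close>

definition mconst :: "complex \<Rightarrow> mpoly" where
  "mconst c = Poly_Mapping.single 0 c"

lemma mconst_0 [simp]: "mconst 0 = 0"
  and mconst_1 [simp]: "mconst 1 = 1"
  and mconst_add: "mconst (c + d) = mconst c + mconst d"
  and mconst_mult: "mconst (c * d) = mconst c * mconst d"
  and mconst_uminus: "mconst (- c) = - mconst c"
  by (simp_all add: mconst_def single_add mult_single single_uminus)

lemma mconst_eq_0_iff [simp]: "mconst c = 0 \<longleftrightarrow> c = 0"
  by (metis mconst_def lookup_single_eq lookup_zero single_zero)

lemma poly_mapping_sum_singles:
  fixes p :: "'a \<Rightarrow>\<^sub>0 'b::comm_monoid_add"
  shows "(\<Sum>m\<in>Poly_Mapping.keys p. Poly_Mapping.single m (Poly_Mapping.lookup p m)) = p"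
proof (rule poly_mapping_eqI)
  fix k
  show "Poly_Mapping.lookup (\<Sum>m\<in>Poly_Mapping.keys p. Poly_Mapping.single m (Poly_Mapping.lookup p m)) k
      = Poly_Mapping.lookup p k"
    by (simp add: lookup_sum lookup_single when_def sum.delta not_in_keys_iff_lookup_eq_zero)
qed

lemma var_power: "var i ^ k = Poly_Mapping.single (Poly_Mapping.single i k) 1"
  by (induction k) (simp_all add: var_def mult_single flip: single_add)

lemma prod_single_1:
  "(\<Prod>i\<in>A. Poly_Mapping.single (g i) 1) = (Poly_Mapping.single (\<Sum>i\<in>A. g i) 1 :: mpoly)"
  by (induction A rule: infinite_finite_induct) (simp_all add: mult_single)

lemma single_eq_mconst_times_vars:
  "Poly_Mapping.single m c =
    mconst c * (\<Prod>i\<in>Poly_Mapping.keys m. var i ^ Poly_Mapping.lookup m i)"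
  by (simp add: var_power prod_single_1 poly_mapping_sum_singles mconst_def mult_single)

text \<open>Constants and variables generate the ring. Identities between substitutions and
  derivations therefore reduce to these two cases.\<close>

lemma mpoly_induct [case_names const var add mult]:
  assumes const: "\<And>c. P (mconst c)" and var: "\<And>i. P (var i)"
    and add: "\<And>p q. P p \<Longrightarrow> P q \<Longrightarrow> P (p + q)"
    and mult: "\<And>p q. P p \<Longrightarrow> P q \<Longrightarrow> P (p * q)"
  shows "P p"
proof -
  have 1: "P 1" and 0: "P 0" using const[of 1] const[of 0] by simp_all
  have pow: "P (var i ^ k)" for i k
    by (induction k) (auto intro: 1 var mult)
  have prod: "P (\<Prod>i\<in>A. var i ^ g i)" for A g
    by (induction A rule: infinite_finite_induct) (auto intro: 1 pow mult)
  have "P (Poly_Mapping.single m c)" for m c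
    unfolding single_eq_mconst_times_vars by (intro mult const prod)
  then have "P (\<Sum>m\<in>A. Poly_Mapping.single m (g m))" for A g
    by (induction A rule: infinite_finite_induct) (auto intro: 0 add)
  from this[of "Poly_Mapping.lookup p" "Poly_Mapping.keys p"] show ?thesis
    by (simp add: poly_mapping_sum_singles)
qed

text \<open>The target ring stays arbitrary because substitution is used in two ways: with values in
  \<open>mpoly poly\<close>, to read off powers of one variable or degrees, and with values in
  \<open>mpoly\<close>, to set variables to zero.\<close>

locale coeff_hom =
  fixes \<iota> :: "complex \<Rightarrow> 'b::comm_ring_1"
  assumes hom_0: "\<iota> 0 = 0" and hom_1: "\<iota> 1 = 1"
    and hom_add: "\<iota> (c + d) = \<iota> c + \<iota> d"
    and hom_mult: "\<iota> (c * d) = \<iota> c * \<iota> d"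
begin

definition monom_val :: "(nat \<Rightarrow> 'b) \<Rightarrow> (nat \<Rightarrow>\<^sub>0 nat) \<Rightarrow> 'b" where
  "monom_val \<sigma> m = (\<Prod>i\<in>Poly_Mapping.keys m. \<sigma> i ^ Poly_Mapping.lookup m i)"

definition ev :: "(nat \<Rightarrow> 'b) \<Rightarrow> mpoly \<Rightarrow> 'b" where
  "ev \<sigma> p = (\<Sum>m\<in>Poly_Mapping.keys p. \<iota> (Poly_Mapping.lookup p m) * monom_val \<sigma> m)"

lemma monom_val_superset:
  assumes "finite A" "Poly_Mapping.keys m \<subseteq> A"
  shows "monom_val \<sigma> m = (\<Prod>i\<in>A. \<sigma> i ^ Poly_Mapping.lookup m i)"
  unfolding monom_val_def using assms
  by (intro prod.mono_neutral_left) (auto simp: not_in_keys_iff_lookup_eq_zero)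

lemma monom_val_add: "monom_val \<sigma> (m + m') = monom_val \<sigma> m * monom_val \<sigma> m'"
proof -
  define A where "A = Poly_Mapping.keys m \<union> Poly_Mapping.keys m'"
  have "finite A" by (simp add: A_def)
  moreover have "Poly_Mapping.keys (m + m') \<subseteq> A" "Poly_Mapping.keys m \<subseteq> A" "Poly_Mapping.keys m' \<subseteq> A"
    using keys_add[of m m'] by (auto simp: A_def)
  ultimately show ?thesis
    by (simp add: monom_val_superset lookup_add power_add prod.distrib)
qed

lemma ev_superset:
  assumes "finite A" "Poly_Mapping.keys p \<subseteq> A"
  shows "ev \<sigma> p = (\<Sum>m\<in>A. \<iota> (Poly_Mapping.lookup p m) * monom_val \<sigma> m)"
  unfolding ev_def using assms
  by (intro sum.mono_neutral_left) (auto simp: not_in_keys_iff_lookup_eq_zero hom_0)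

lemma ev_single: "ev \<sigma> (Poly_Mapping.single m c) = \<iota> c * monom_val \<sigma> m"
  by (subst ev_superset[of "{m}"]) (auto simp: keys_single)

lemma ev_0 [simp]: "ev \<sigma> 0 = 0"
  by (simp add: ev_def)

lemma ev_mconst [simp]: "ev \<sigma> (mconst c) = \<iota> c"
  by (simp add: mconst_def ev_single monom_val_def)

lemma ev_1 [simp]: "ev \<sigma> 1 = 1"
  using ev_mconst[of \<sigma> 1] by (simp add: hom_1)

lemma ev_var [simp]: "ev \<sigma> (var i) = \<sigma> i"
  by (simp add: var_def ev_single monom_val_def hom_1)

lemma ev_add [simp]: "ev \<sigma> (p + q) = ev \<sigma> p + ev \<sigma> q"
proof -
  define A where "A = Poly_Mapping.keys p \<union> Poly_Mapping.keys q"
  have "finite A" by (simp add: A_def)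
  moreover have "Poly_Mapping.keys (p + q) \<subseteq> A" "Poly_Mapping.keys p \<subseteq> A" "Poly_Mapping.keys q \<subseteq> A"
    using keys_add[of p q] by (auto simp: A_def)
  ultimately show ?thesis
    by (simp add: ev_superset lookup_add hom_add ring_distribs sum.distrib)
qed

lemma ev_sum [simp]: "ev \<sigma> (\<Sum>x\<in>A. h x) = (\<Sum>x\<in>A. ev \<sigma> (h x))"
  by (induction A rule: infinite_finite_induct) auto

lemma ev_mult [simp]: "ev \<sigma> (p * q) = ev \<sigma> p * ev \<sigma> q"
proof -
  let ?s = "\<lambda>p m. Poly_Mapping.single m (Poly_Mapping.lookup p m)"
  have "ev \<sigma> (?s p m * ?s q m') = ev \<sigma> (?s p m) * ev \<sigma> (?s q m')" for m m'
    by (simp add: mult_single ev_single monom_val_add hom_mult)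
  then have "ev \<sigma> ((\<Sum>m\<in>Poly_Mapping.keys p. ?s p m) * (\<Sum>m\<in>Poly_Mapping.keys q. ?s q m)) =
    ev \<sigma> (\<Sum>m\<in>Poly_Mapping.keys p. ?s p m) * ev \<sigma> (\<Sum>m\<in>Poly_Mapping.keys q. ?s q m)"
    by (simp add: sum_product)
  then show ?thesis by (simp add: poly_mapping_sum_singles)
qed

lemma ev_uminus [simp]: "ev \<sigma> (- p) = - ev \<sigma> p"
  using ev_add[of \<sigma> p "- p"] by (simp add: eq_neg_iff_add_eq_0 add.commute)

lemma ev_diff [simp]: "ev \<sigma> (p - q) = ev \<sigma> p - ev \<sigma> q"
  using ev_add[of \<sigma> p "- q"] by simp

lemma ev_power [simp]: "ev \<sigma> (p ^ k) = ev \<sigma> p ^ k"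
  by (induction k) auto

end

interpretation into_poly: coeff_hom "\<lambda>c. [:mconst c:]"
  by unfold_locales (simp_all add: mconst_add mconst_mult one_pCons)

interpretation into_mpoly: coeff_hom mconst
  by unfold_locales (simp_all add: mconst_add mconst_mult)

text \<open>\<open>in_var k\<close> reads a polynomial as one in \<open>x\<^sub>k\<close>; \<open>by_degree\<close> substitutes \<open>x\<^sub>i T\<close> for \<open>x\<^sub>i\<close>, so its
  coefficients are the homogeneous components.\<close>

definition in_var :: "nat \<Rightarrow> mpoly \<Rightarrow> mpoly poly" where
  "in_var k = into_poly.ev (\<lambda>i. if i = k then [:0, 1:] else [:var i:])"

definition drop_var :: "nat \<Rightarrow> mpoly \<Rightarrow> mpoly" where
  "drop_var k p = poly (in_var k p) 0"

definition pdiff :: "nat \<Rightarrow> mpoly \<Rightarrow> mpoly" where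
  "pdiff k p = poly (pderiv (in_var k p)) (var k)"

definition by_degree :: "mpoly \<Rightarrow> mpoly poly" where
  "by_degree = into_poly.ev (\<lambda>i. [:0, var i:])"

lemma in_var_simps [simp]:
  "in_var k (mconst c) = [:mconst c:]" "in_var k 0 = 0" "in_var k 1 = 1"
  "in_var k (p + q) = in_var k p + in_var k q" "in_var k (p - q) = in_var k p - in_var k q"
  "in_var k (- p) = - in_var k p" "in_var k (p * q) = in_var k p * in_var k q"
  "in_var k (p ^ e) = in_var k p ^ e" "in_var k (sum h A) = (\<Sum>x\<in>A. in_var k (h x))"
  by (simp_all add: in_var_def)

lemma in_var_var: "in_var k (var i) = (if i = k then [:0, 1:] else [:var i:])"
  by (simp add: in_var_def)

lemma drop_var_simps [simp]:
  "drop_var k (mconst c) = mconst c" "drop_var k 0 = 0" "drop_var k 1 = 1"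
  "drop_var k (p + q) = drop_var k p + drop_var k q" "drop_var k (p - q) = drop_var k p - drop_var k q"
  "drop_var k (- p) = - drop_var k p" "drop_var k (p * q) = drop_var k p * drop_var k q"
  "drop_var k (p ^ e) = drop_var k p ^ e" "drop_var k (sum h A) = (\<Sum>x\<in>A. drop_var k (h x))"
  by (simp_all add: drop_var_def poly_sum)

lemma drop_var_var: "drop_var k (var i) = (if i = k then 0 else var i)"
  by (simp add: drop_var_def in_var_var)

lemma drop_var_same [simp]: "drop_var k (var k) = 0"
  by (simp add: drop_var_var)

lemma by_degree_simps [simp]:
  "by_degree (mconst c) = [:mconst c:]" "by_degree 0 = 0" "by_degree 1 = 1"
  "by_degree (p + q) = by_degree p + by_degree q" "by_degree (p - q) = by_degree p - by_degree q"
  "by_degree (- p) = - by_degree p" "by_degree (p * q) = by_degree p * by_degree q"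
  "by_degree (p ^ e) = by_degree p ^ e" "by_degree (sum h A) = (\<Sum>x\<in>A. by_degree (h x))"
  "by_degree (var i) = [:0, var i:]"
  by (simp_all add: by_degree_def)

lemma poly_in_var: "poly (in_var k p) (var k) = p"
  by (induction p rule: mpoly_induct) (auto simp: in_var_var)

lemma poly_by_degree_1: "poly (by_degree p) 1 = p"
  by (induction p rule: mpoly_induct) auto

lemma var_neq_0 [simp]: "var i \<noteq> 0"
  by (metis var_def lookup_single_eq lookup_zero one_neq_zero)

lemma drop_var_idem: "drop_var k (drop_var k p) = drop_var k p"
  by (induction p rule: mpoly_induct) (auto simp: drop_var_var)

lemma var_dvd_diff_drop_var: "var k dvd p - drop_var k p"
proof (induction p rule: mpoly_induct)
  case (mult p q)
  have "p * q - drop_var k (p * q) = (p - drop_var k p) * q + drop_var k p * (q - drop_var k q)"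
    by (simp add: algebra_simps)
  then show ?case using mult by simp
next
  case (add p q)
  then show ?case by (metis (no_types, lifting) add_diff_add drop_var_simps(4) dvd_add)
qed (auto simp: drop_var_var)

lemma drop_var_eq_0_iff: "drop_var k p = 0 \<longleftrightarrow> var k dvd p"
proof
  assume "drop_var k p = 0"
  then show "var k dvd p" using var_dvd_diff_drop_var[of k p] by simp
qed (auto elim: dvdE)

lemma drop_var_cofactor:
  obtains q where "p = drop_var k p + var k * q"
  using var_dvd_diff_drop_var[of k p] by (auto elim!: dvdE simp: algebra_simps)

section \<open>Ideals generated by two homogeneous polynomials\<close>

text \<open>Cofactors range over polynomials in all variables, whatever the generators involve. The
  ideals of the ring in \<open>n\<close> variables are recovered at the end by
  \<open>gen_ideal_two\<close>.\<close>

definition gen2 :: "mpoly \<Rightarrow> mpoly \<Rightarrow> mpoly set" where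
  "gen2 f g = {u * f + v * g | u v. True}"

lemma gen2I [intro?]: "u * f + v * g \<in> gen2 f g"
  by (auto simp: gen2_def)

lemma gen2E [elim?]:
  assumes "h \<in> gen2 f g" obtains u v where "h = u * f + v * g"
  using assms by (auto simp: gen2_def)

lemma gen2_0 [simp]: "0 \<in> gen2 f g"
  using gen2I[of 0 f 0 g] by simp

lemma gen2_left [simp]: "f \<in> gen2 f g" and gen2_right [simp]: "g \<in> gen2 f g"
  using gen2I[of 1 f 0 g] gen2I[of 0 f 1 g] by simp_all

lemma gen2_add:
  assumes "p \<in> gen2 f g" "q \<in> gen2 f g" shows "p + q \<in> gen2 f g"
proof -
  obtain u v u' v' where "p = u * f + v * g" "q = u' * f + v' * g"
    using assms by (metis gen2E)
  then have "p + q = (u + u') * f + (v + v') * g" by (simp add: algebra_simps)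
  then show ?thesis by (metis gen2I)
qed

lemma gen2_mult_left:
  assumes "q \<in> gen2 f g" shows "p * q \<in> gen2 f g"
proof -
  obtain u v where "q = u * f + v * g" using assms by (rule gen2E)
  then have "p * q = (p * u) * f + (p * v) * g" by (simp add: algebra_simps)
  then show ?thesis by (metis gen2I)
qed

lemma gen2_mult_right: "q \<in> gen2 f g \<Longrightarrow> q * p \<in> gen2 f g"
  by (subst mult.commute) (rule gen2_mult_left)

lemma gen2_uminus: "p \<in> gen2 f g \<Longrightarrow> - p \<in> gen2 f g"
  using gen2_mult_left[of p f g "- 1"] by simp

lemma gen2_diff: "p \<in> gen2 f g \<Longrightarrow> q \<in> gen2 f g \<Longrightarrow> p - q \<in> gen2 f g"
  using gen2_add[OF _ gen2_uminus] by fastforce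

lemma gen2_dvd: "p \<in> gen2 f g \<Longrightarrow> p dvd q \<Longrightarrow> q \<in> gen2 f g"
  by (auto elim!: dvdE intro: gen2_mult_right)

lemma gen2_drop_var: "h \<in> gen2 f g \<Longrightarrow> drop_var t h \<in> gen2 (drop_var t f) (drop_var t g)"
  by (elim gen2E) (simp add: gen2I)

lemma coeff_by_degree_drop_var:
  "coeff (by_degree (drop_var t p)) e = drop_var t (coeff (by_degree p) e)"
  by (induction p arbitrary: e rule: mpoly_induct)
     (auto simp: drop_var_var coeff_mult coeff_pCons split: nat.splits)

text \<open>Components multiply as in a graded ring. The equation
  \<open>by_degree f = monom f a\<close> is the way homogeneity of degree \<open>a\<close> is
  expressed from here on; it covers \<open>f = 0\<close> for every \<open>a\<close>.\<close>

lemma by_degree_component: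
  "by_degree (coeff (by_degree p) e) = monom (coeff (by_degree p) e) e"
proof (induction p arbitrary: e rule: mpoly_induct)
  case (mult p q)
  have "by_degree (coeff (by_degree (p * q)) e) =
    (\<Sum>i\<le>e. monom (coeff (by_degree p) i) i * monom (coeff (by_degree q) (e - i)) (e - i))"
    using mult by (simp add: coeff_mult)
  also have "\<dots> = (\<Sum>i\<le>e. monom (coeff (by_degree p) i * coeff (by_degree q) (e - i)) e)"
    by (intro sum.cong refl) (auto simp: mult_monom)
  also have "\<dots> = monom (coeff (by_degree (p * q)) e) e"
    by (simp add: coeff_mult poly_eq_iff coeff_sum)
  finally show ?case .
next
  case (add p q)
  then show ?case by (simp add: add_monom)
qed (auto simp: coeff_pCons monom_0 monom_Suc split: nat.splits)

lemma sum_components: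
  assumes "\<And>e. e \<ge> d \<Longrightarrow> coeff (by_degree p) e = 0"
  shows "(\<Sum>e<d. coeff (by_degree p) e) = p"
proof -
  have "p = (\<Sum>e\<le>degree (by_degree p). coeff (by_degree p) e)"
    using poly_by_degree_1[of p] by (simp add: poly_altdef)
  also have "\<dots> = (\<Sum>e<d. coeff (by_degree p) e)"
    using assms by (intro sum.mono_neutral_cong) (auto simp: coeff_eq_0)
  finally show ?thesis by simp
qed

lemma coeff_by_degree_mult_homogeneous:
  assumes "by_degree f = monom f a"
  shows "coeff (by_degree (u * f)) e = (if a \<le> e then coeff (by_degree u) (e - a) * f else 0)"
proof -
  have "by_degree (u * f) = monom f a * by_degree u"
    by (simp only: by_degree_simps assms mult.commute)
  then show ?thesis by (simp only: coeff_monom_mult) (simp add: mult.commute)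
qed

text \<open>Compare the components of degree below \<open>d\<close> on both sides. If
  \<open>d < a\<close>, truncated subtraction makes the first sum empty, in accordance with
  multiples of \<open>f\<close> having no components below degree \<open>a\<close>.\<close>

lemma homogeneous_gen2_truncate:
  assumes "by_degree f = monom f a" and "by_degree g = monom g b"
    and "\<And>e. e \<ge> d \<Longrightarrow> coeff (by_degree (u * f + v * g)) e = 0"
  shows "u * f + v * g = (\<Sum>e<d - a. coeff (by_degree u) e) * f + (\<Sum>e<d - b. coeff (by_degree v) e) * g"
proof -
  have shift: "(\<Sum>e<d. if a \<le> e then c (e - a) * f else 0) = (\<Sum>e<d - a. c e) * f"
    for c :: "nat \<Rightarrow> mpoly" and f :: mpoly and a
  proof -
    have "(\<Sum>e<d. if a \<le> e then c (e - a) * f else 0) = (\<Sum>e\<in>{a..<d}. c (e - a) * f)"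
      by (intro sum.mono_neutral_cong_right) auto
    also have "\<dots> = (\<Sum>e<d - a. c e * f)"
      by (rule sum.reindex_bij_witness[of _ "\<lambda>e. e + a" "\<lambda>e. e - a"]) auto
    finally show ?thesis by (simp add: sum_distrib_right)
  qed
  have "u * f + v * g = (\<Sum>e<d. coeff (by_degree (u * f + v * g)) e)"
    using sum_components[OF assms(3)] by simp
  also have "\<dots> = (\<Sum>e<d. coeff (by_degree (u * f)) e) + (\<Sum>e<d. coeff (by_degree (v * g)) e)"
    by (simp add: sum.distrib)
  finally show ?thesis
    by (simp only: coeff_by_degree_mult_homogeneous[OF assms(1)]
        coeff_by_degree_mult_homogeneous[OF assms(2)] shift)
qed

lemma coeff_by_degree_sum_components:
  "coeff (by_degree (\<Sum>e<k. coeff (by_degree u) e)) j = (if j < k then coeff (by_degree u) j else 0)"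
  by (simp add: by_degree_component coeff_sum)

text \<open>The lifting principle. Lift the reduction of \<open>h\<close> and subtract: the
  difference is divisible by \<open>var t\<close>, and the quotient lies in \<open>N\<close> and has
  smaller degree. Typical choices of \<open>N\<close> are a colon ideal and the set of all zero
  divisors modulo \<open>gen2 f g\<close>, which is no ideal a priori.\<close>

lemma subset_gen2_by_dropping_var:
  assumes f: "by_degree f = monom f a" and g: "by_degree g = monom g b"
    and N: "\<And>h u v. h \<in> N \<Longrightarrow> h - (u * f + v * g) \<in> N"
    and low: "\<And>h. h \<in> N \<Longrightarrow> drop_var t h \<in> gen2 (drop_var t f) (drop_var t g)"
    and t: "\<And>h. var t * h \<in> N \<Longrightarrow> h \<in> N"
  shows "N \<subseteq> gen2 f g"
proof -
  have hom: "by_degree (drop_var t f) = monom (drop_var t f) a"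
            "by_degree (drop_var t g) = monom (drop_var t g) b"
    using f g by (simp_all add: poly_eq_iff coeff_by_degree_drop_var)
  have "h \<in> gen2 f g" if "h \<in> N" "\<And>e. e \<ge> d \<Longrightarrow> coeff (by_degree h) e = 0" for d h
    using that
  proof (induction d arbitrary: h)
    case 0
    then have "by_degree h = 0" by (simp add: poly_eq_iff)
    then have "h = 0" using poly_by_degree_1[of h] by simp
    then show ?case by simp
  next
    case (Suc d)
    obtain u v where uv: "drop_var t h = u * drop_var t f + v * drop_var t g"
      using low[OF Suc.prems(1)] by (elim gen2E)
    \<comment> \<open>Cutting the cofactors keeps the correction \<open>u' * f + v' * g\<close>
      below degree \<open>Suc d\<close>, so that \<open>k\<close> obeys the same bound as
      \<open>h\<close>.\<close>
    define u' where "u' = (\<Sum>e<Suc d - a. coeff (by_degree u) e)"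
    define v' where "v' = (\<Sum>e<Suc d - b. coeff (by_degree v) e)"
    have "coeff (by_degree (u * drop_var t f + v * drop_var t g)) e = 0" if "e \<ge> Suc d" for e
      using Suc.prems(2)[OF that] by (simp only: flip: uv) (simp add: coeff_by_degree_drop_var)
    from homogeneous_gen2_truncate[OF hom this]
    have h0: "drop_var t h = u' * drop_var t f + v' * drop_var t g"
      by (simp only: uv u'_def v'_def)
    define k where "k = h - (u' * f + v' * g)"
    have "k \<in> N" unfolding k_def by (rule N[OF Suc.prems(1)])
    have "drop_var t k = 0"
      using arg_cong[OF h0, of "drop_var t"] by (simp add: k_def drop_var_idem)
    then obtain q where q: "k = var t * q"
      by (auto simp: drop_var_eq_0_iff elim: dvdE)
    have kz: "coeff (by_degree k) e = 0" if "e \<ge> Suc d" for e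
    proof -
      have "coeff (by_degree (u' * f)) e = 0" "coeff (by_degree (v' * g)) e = 0"
        using that unfolding u'_def v'_def
        by (simp_all only: coeff_by_degree_mult_homogeneous[OF f]
          coeff_by_degree_mult_homogeneous[OF g] coeff_by_degree_sum_components) auto
      then show ?thesis using Suc.prems(2)[OF that] by (simp add: k_def)
    qed
    have "coeff (by_degree q) e = 0" if "e \<ge> d" for e
      using kz[of "Suc e"] that by (simp add: q)
    then have "q \<in> gen2 f g"
      using Suc.IH[of q] t[of q] \<open>k \<in> N\<close> q by simp
    then have "k + (u' * f + v' * g) \<in> gen2 f g"
      unfolding q by (intro gen2_add gen2_mult_left gen2I)
    then show ?case by (simp add: k_def)
  qed
  from this[of _ "Suc (degree (by_degree _))"] show ?thesis
    by (metis coeff_eq_0 Suc_le_eq subsetI)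
qed

section \<open>Regularity modulo two power sums\<close>

definition power_sum :: "nat set \<Rightarrow> nat \<Rightarrow> mpoly" where
  "power_sum V d = (\<Sum>i\<in>V. var i ^ d)"

lemma linear_power_eq_monom: "[:0, c:] ^ d = monom (c ^ d) d" for c :: "'a::comm_semiring_1"
proof -
  have "[:0, c:] = monom c 1" by (simp add: monom_altdef)
  then show ?thesis by (simp only: monom_power mult_1)
qed

lemma by_degree_power_sum: "by_degree (power_sum V d) = monom (power_sum V d) d"
  by (simp add: power_sum_def linear_power_eq_monom poly_eq_iff coeff_sum)

lemma drop_var_power_sum:
  assumes "finite V" "d > 0"
  shows "drop_var t (power_sum V d) = power_sum (V - {t}) d"
  unfolding power_sum_def using assms
  by (simp, intro sum.mono_neutral_cong_right) (auto simp: drop_var_var)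

text \<open>Read as a polynomial in \<open>var i\<close>, the power sum has coefficient 1 at degree
  \<open>d\<close>.\<close>

lemma power_sum_neq_0:
  assumes "finite V" "i \<in> V" "d > 0"
  shows "power_sum V d \<noteq> 0"
proof -
  have "coeff ([:var j:] ^ d) d = 0" for j
    using assms(3) by (simp add: poly_const_pow coeff_pCons split: nat.splits)
  then have "coeff (in_var i (var j ^ d)) d = (if j = i then 1 else 0)" for j
    by (simp add: in_var_var linear_power_eq_monom)
  then have "coeff (in_var i (power_sum V d)) d = (\<Sum>j\<in>V. if j = i then 1 else 0)"
    unfolding power_sum_def in_var_simps(9) coeff_sum by (rule sum.cong[OF refl])
  also have "\<dots> = 1" using assms by simp
  finally show ?thesis by (metis coeff_0 in_var_simps(2) one_neq_zero)
qed

lemma diff_dvd_power_diff: "(x::'a::comm_ring_1) - y dvd x ^ n - y ^ n"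
proof (induction n)
  case (Suc n)
  have "x ^ Suc n - y ^ Suc n = x * (x ^ n - y ^ n) + (x - y) * y ^ n"
    by (simp add: algebra_simps)
  then show ?case using Suc by simp
qed simp

text \<open>Setting \<open>var t\<close> to zero in \<open>var t * v = power_sum V d * s\<close>
  kills the left side but not the power sum, so \<open>var t\<close> divides \<open>s\<close> and
  can be cancelled.\<close>

lemma power_sum_dvd_cancel_var:
  assumes "finite V" "V - {t} \<noteq> {}" "d > 0" "power_sum V d dvd var t * v"
  shows "power_sum V d dvd v"
proof -
  obtain s where s: "var t * v = power_sum V d * s" using assms(4) by (elim dvdE)
  have "power_sum (V - {t}) d * drop_var t s = 0"
    using arg_cong[OF s, of "drop_var t"] assms by (simp add: drop_var_power_sum)
  moreover have "power_sum (V - {t}) d \<noteq> 0"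
    using assms power_sum_neq_0[of "V - {t}"] by blast
  ultimately obtain r where "s = var t * r"
    by (auto simp: drop_var_eq_0_iff elim: dvdE)
  with s have "var t * v = var t * (power_sum V d * r)" by (simp add: algebra_simps)
  then show ?thesis by simp
qed

lemma mconst_half: "mconst (1/2) * 2 = 1"
proof -
  have "mconst (1/2) * 2 = mconst (1/2) * mconst 2" by (simp add: mconst_def)
  also have "\<dots> = 1" by (simp flip: mconst_mult)
  finally show ?thesis .
qed

lemma two_dvd_mpoly: "(f::mpoly) dvd 2 * v \<longleftrightarrow> f dvd v"
proof
  assume "f dvd 2 * v"
  then have "f dvd mconst (1/2) * (2 * v)" by simp
  then show "f dvd v" by (simp add: mconst_half flip: mult.assoc)
qed simp

text \<open>The last two conditions say that \<open>b - a\<close> is prime to 6. They exclude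
  vanishing sums of up to four roots of unity whose order divides \<open>b - a\<close>.\<close>

locale power_sum_pair =
  fixes a b :: nat
  assumes a_pos: "0 < a" and a_less_b: "a < b"
    and odd_diff: "odd (b - a)" and not_3_dvd_diff: "\<not> 3 dvd (b - a)"
begin

lemma b_pos: "0 < b" using a_pos a_less_b by simp

text \<open>The exponents \<open>a\<close> and \<open>b\<close> have opposite parity. The difference
  is the coefficient that appears when one of two variables is eliminated, and it is a unit in
  \<open>mpoly\<close>.\<close>

lemma sign_diff: "(-1) ^ b - (-1) ^ a \<in> {2, - 2 :: 'a::comm_ring_1}"
proof -
  have "even a \<longleftrightarrow> odd b" using odd_diff a_less_b by (simp add: even_diff_nat) 
  then show ?thesis by (cases "even a") simp_all
qed

abbreviation I :: "nat set \<Rightarrow> mpoly set" where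
  "I V \<equiv> gen2 (power_sum V a) (power_sum V b)"

lemma I_drop_var:
  assumes "finite V" "h \<in> I V"
  shows "drop_var t h \<in> I (V - {t})"
  using gen2_drop_var[OF assms(2), of t] by (simp add: drop_var_power_sum assms a_pos b_pos)

text \<open>Evaluate \<open>y^(a b)\<close> in two ways: it is \<open>(- x^a)^b\<close> modulo
  \<open>f\<close> and \<open>(- x^b)^a\<close> modulo \<open>g\<close>. Times \<open>v\<close>,
  both congruences hold modulo \<open>f\<close>, so \<open>f\<close> divides \<open>v\<close> times
  a unit times a power of \<open>x\<close>, and the power of \<open>x\<close> cancels.\<close>

lemma power_sum_coprime_2:
  assumes "x \<noteq> y" and dvd: "power_sum {x, y} a dvd v * power_sum {x, y} b"
  shows "power_sum {x, y} a dvd v"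
proof -
  define f g where "f = power_sum {x, y} a" and "g = power_sum {x, y} b"
  have fg: "f = var x ^ a + var y ^ a" "g = var x ^ b + var y ^ b"
    using assms by (simp_all add: f_def g_def power_sum_def)
  have "(f - var x ^ a) ^ b = (g - var x ^ b) ^ a"
    by (simp add: fg mult.commute flip: power_mult)
  moreover have "f dvd v * ((f - var x ^ a) ^ b - (- (var x ^ a)) ^ b)"
    using diff_dvd_power_diff[of "f - var x ^ a" "- (var x ^ a)" b] by (simp add: dvd_mult)
  moreover have "f dvd v * ((g - var x ^ b) ^ a - (- (var x ^ b)) ^ a)"
  proof -
    have "g dvd (g - var x ^ b) ^ a - (- (var x ^ b)) ^ a"
      using diff_dvd_power_diff[of "g - var x ^ b" "- (var x ^ b)" a] by simp
    then have "v * g dvd v * ((g - var x ^ b) ^ a - (- (var x ^ b)) ^ a)" by (rule mult_dvd_mono[OF dvd_refl])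
    with dvd show ?thesis unfolding f_def g_def by (rule dvd_trans)
  qed
  ultimately have "f dvd v * ((g - var x ^ b) ^ a - (- (var x ^ b)) ^ a) - v * ((g - var x ^ b) ^ a - (- (var x ^ a)) ^ b)"
    by (metis dvd_diff)
  also have "v * ((g - var x ^ b) ^ a - (- (var x ^ b)) ^ a) - v * ((g - var x ^ b) ^ a - (- (var x ^ a)) ^ b)
      = v * ((- (var x ^ a)) ^ b - (- (var x ^ b)) ^ a)"
    by (simp add: algebra_simps)
  also have "(- (var x ^ a)) ^ b - (- (var x ^ b)) ^ a = ((-1) ^ b - (-1) ^ a) * var x ^ (a * b)"
    by (simp add: power_minus[of "var x ^ _"] algebra_simps flip: power_mult)
  finally have *: "f dvd v * (((-1) ^ b - (-1) ^ a) * var x ^ (a * b))" .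
  have "f dvd 2 * (var x ^ (a * b) * v)"
    using sign_diff[where 'a = mpoly]
  proof (elim insertE emptyE)
    assume "(-1) ^ b - (-1) ^ a = (2::mpoly)"
    with * show ?thesis by (simp only: ac_simps)
  next
    assume "(-1) ^ b - (-1) ^ a = (-2::mpoly)"
    with * show ?thesis by (simp only: ac_simps mult_minus_left mult_minus_right dvd_minus_iff)
  qed
  then have "f dvd var x ^ (a * b) * v" by (simp add: two_dvd_mpoly)
  moreover have "f dvd v" if "f dvd var x ^ k * v" for k
    using that
  proof (induction k)
    case (Suc k)
    have 1: "f dvd var x * (var x ^ k * v)"
      using Suc.prems by (simp only: power_Suc mult.assoc)
    have 2: "{x, y} - {x} \<noteq> {}" using assms(1) by blast
    have "f dvd var x ^ k * v"
      by (rule power_sum_dvd_cancel_var[OF _ 2 a_pos 1[unfolded f_def], folded f_def]) simp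
    then show ?case by (rule Suc.IH)
  qed simp
  ultimately show ?thesis by (simp add: f_def)
qed

lemma power_sum_coprime:
  assumes "finite V" "card V \<ge> 2" "power_sum V a dvd v * power_sum V b"
  shows "power_sum V a dvd v"
  using assms
proof (induction "card V" arbitrary: V v rule: less_induct)
  case less
  show ?case
  proof (cases "card V = 2")
    case True
    then obtain x y where "V = {x, y}" "x \<noteq> y" by (auto simp: card_2_iff)
    with less.prems power_sum_coprime_2 show ?thesis by blast
  next
    case False
    with less.prems have card: "card V \<ge> 3" by simp
    then have "V \<noteq> {}" by auto
    then obtain t where t: "t \<in> V" by blast
    have card': "card (V - {t}) \<ge> 2" "card (V - {t}) < card V"
      using card t less.prems by (simp_all add: card_Diff_singleton)
    then have ne: "V - {t} \<noteq> {}" by (metis card.empty not_numeral_le_zero)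
    let ?f = "power_sum V a" and ?g = "power_sum V b"
    \<comment> \<open>The zero polynomial is homogeneous of every degree. As second generator it
      turns membership in \<open>gen2\<close> into divisibility by \<open>?f\<close>.\<close>
    have "{v. ?f dvd v * ?g} \<subseteq> gen2 ?f 0"
    proof (rule subset_gen2_by_dropping_var[where t = t and a = a and b = b])
      fix h u v :: mpoly assume "h \<in> {v. ?f dvd v * ?g}"
      then show "h - (u * ?f + v * 0) \<in> {v. ?f dvd v * ?g}"
        by (simp add: algebra_simps)
    next
      fix h assume "h \<in> {v. ?f dvd v * ?g}"
      then obtain s where "h * ?g = ?f * s" by (auto elim: dvdE)
      from arg_cong[OF this, of "drop_var t"]
      have "power_sum (V - {t}) a dvd drop_var t h * power_sum (V - {t}) b"
        using less.prems by (simp add: drop_var_power_sum a_pos b_pos)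
      then have "power_sum (V - {t}) a dvd drop_var t h"
        by (rule less.hyps[OF card'(2) finite_Diff[OF less.prems(1)] card'(1)])
      then obtain s where "drop_var t h = power_sum (V - {t}) a * s" by (rule dvdE)
      then have "drop_var t h = s * drop_var t ?f + 0 * drop_var t 0"
        using less.prems(1) by (simp add: drop_var_power_sum a_pos mult.commute)
      then show "drop_var t h \<in> gen2 (drop_var t ?f) (drop_var t 0)"
        by (metis gen2I)
    next
      fix h assume "var t * h \<in> {v. ?f dvd v * ?g}"
      then have "?f dvd var t * (h * ?g)" by (simp add: mult.assoc)
      then have "?f dvd h * ?g" by (rule power_sum_dvd_cancel_var[OF less.prems(1) ne a_pos])
      then show "h \<in> {v. ?f dvd v * ?g}" by simp
    qed (simp_all add: by_degree_power_sum)
    then have "v \<in> gen2 ?f 0" using less.prems(3) by blast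
    then show ?thesis by (auto simp: gen2_def)
  qed
qed

text \<open>Write \<open>var t * h = u * f + v * g\<close> and set \<open>var t\<close> to zero. By
  coprimality the resulting relation between \<open>f0\<close> and \<open>g0\<close> is a multiple
  of the trivial one. Lifting and subtracting that multiple leaves cofactors divisible by
  \<open>var t\<close>.\<close>

lemma var_regular:
  assumes "finite V" "card (V - {t}) \<ge> 2" "var t * h \<in> I V"
  shows "h \<in> I V"
proof -
  define f g f0 g0 where "f = power_sum V a" and "g = power_sum V b"
    and "f0 = power_sum (V - {t}) a" and "g0 = power_sum (V - {t}) b"
  have drop: "drop_var t f = f0" "drop_var t g = g0"
    using assms(1) by (simp_all add: f_def g_def f0_def g0_def drop_var_power_sum a_pos b_pos)
  obtain i where "i \<in> V - {t}"
    using assms(2) by (metis card.empty not_numeral_le_zero equals0I)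
  then have "f0 \<noteq> 0" using assms(1) using power_sum_neq_0[of "V - {t}" i a] a_pos by (simp add: f0_def)
  obtain u v where uv: "var t * h = u * f + v * g"
    using assms(3) by (auto simp: f_def g_def elim: gen2E)
  have rel: "drop_var t u * f0 + drop_var t v * g0 = 0"
    using arg_cong[OF uv, of "drop_var t"] by (simp add: drop)
  then have "drop_var t v * g0 = f0 * (- drop_var t u)" by (simp add: algebra_simps eq_neg_iff_add_eq_0)
  then have "f0 dvd drop_var t v * g0" by (metis dvd_triv_left)
  then have "f0 dvd drop_var t v"
    unfolding f0_def g0_def by (rule power_sum_coprime[OF finite_Diff[OF assms(1)] assms(2)])
  then obtain c where c: "drop_var t v = f0 * c" by (elim dvdE)
  have "f0 * (drop_var t u + c * g0) = 0" using rel by (simp add: c algebra_simps)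
  then have c': "drop_var t u = - c * g0"
    using \<open>f0 \<noteq> 0\<close> by (simp add: eq_neg_iff_add_eq_0)
  obtain u1 v1 where uv1: "u = - c * g0 + var t * u1" "v = f0 * c + var t * v1"
    by (metis c c' drop_var_cofactor)
  obtain f1 g1 where fg1: "f = f0 + var t * f1" "g = g0 + var t * g1"
    by (metis drop drop_var_cofactor)
  have "var t * h = var t * ((u1 + c * g1) * f + (v1 - c * f1) * g)"
    unfolding uv by (simp add: uv1 fg1 algebra_simps)
  then have "h = (u1 + c * g1) * f + (v1 - c * f1) * g" by simp
  then show ?thesis unfolding f_def g_def by (metis gen2I)
qed

end

text \<open>The equation \<open>restrict_vars W p = p\<close> serves to say that \<open>p\<close>
  involves only variables from \<open>W\<close>. For \<open>W = {}\<close> the value is the constant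
  term.\<close>

definition restrict_vars :: "nat set \<Rightarrow> mpoly \<Rightarrow> mpoly" where
  "restrict_vars A = into_mpoly.ev (\<lambda>i. if i \<in> A then var i else 0)"

lemma restrict_vars_simps [simp]:
  "restrict_vars A (mconst c) = mconst c" "restrict_vars A 0 = 0" "restrict_vars A 1 = 1"
  "restrict_vars A (p + q) = restrict_vars A p + restrict_vars A q"
  "restrict_vars A (p * q) = restrict_vars A p * restrict_vars A q"
  "restrict_vars A (var i) = (if i \<in> A then var i else 0)"
  "restrict_vars A (p ^ e) = restrict_vars A p ^ e"
  "restrict_vars A (sum h B) = (\<Sum>x\<in>B. restrict_vars A (h x))"
  by (simp_all add: restrict_vars_def)

lemma restrict_vars_restrict_vars: "restrict_vars A (restrict_vars B p) = restrict_vars (A \<inter> B) p"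
  by (induction p rule: mpoly_induct) auto

lemma drop_var_eq_restrict_vars: "drop_var k p = restrict_vars (- {k}) p"
  by (induction p rule: mpoly_induct) (auto simp: drop_var_var)

lemma finite_vars: "\<exists>W. finite W \<and> restrict_vars W p = p"
proof (induction p rule: mpoly_induct)
  case (const c)
  show ?case by (intro exI[of _ "{}"]) simp
next
  case (var i)
  show ?case by (intro exI[of _ "{i}"]) simp
next
  case (add p q)
  then obtain W W' where W: "finite W" "restrict_vars W p = p" "finite W'" "restrict_vars W' q = q" by blast
  then have "restrict_vars (W \<union> W') p = p" "restrict_vars (W \<union> W') q = q"
    using restrict_vars_restrict_vars[of "W \<union> W'" W p] restrict_vars_restrict_vars[of "W \<union> W'" W' q]
    by (simp_all add: Int_absorb1)
  with W show ?case by (intro exI[of _ "W \<union> W'"]) simp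
next
  case (mult p q)
  then obtain W W' where W: "finite W" "restrict_vars W p = p" "finite W'" "restrict_vars W' q = q" by blast
  then have "restrict_vars (W \<union> W') p = p" "restrict_vars (W \<union> W') q = q"
    using restrict_vars_restrict_vars[of "W \<union> W'" W p] restrict_vars_restrict_vars[of "W \<union> W'" W' q]
    by (simp_all add: Int_absorb1)
  with W show ?case by (intro exI[of _ "W \<union> W'"]) simp
qed

lemma restrict_vars_empty: "\<exists>c. restrict_vars {} p = mconst c"
proof (induction p rule: mpoly_induct)
  case (var i)
  show ?case by (intro exI[of _ 0]) simp
qed (auto simp flip: mconst_add mconst_mult)

lemma mconst_mult_cancel:
  assumes "c \<noteq> 0" shows "mconst (1 / c) * (mconst c * h) = h"
  using assms by (simp flip: mult.assoc mconst_mult)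

lemma by_degree_eq_0_iff: "by_degree p = 0 \<longleftrightarrow> p = 0"
  using poly_by_degree_1[of p] by auto

lemma card_Diff_singleton_ge_2:
  assumes "finite V" "i \<in> V" "j \<in> V" "i \<noteq> j" "t \<noteq> i" "t \<noteq> j"
  shows "card (V - {t}) \<ge> 2"
proof -
  have "card {i, j} \<le> card (V - {t})" using assms by (intro card_mono) auto
  then show ?thesis using assms(4) by simp
qed

context power_sum_pair
begin

text \<open>Induction on the variables of \<open>\<beta>\<close>, and for fixed variables on its
  degree. If \<open>var t\<close> divides \<open>\<beta>\<close>, it is cancelled as a regular
  element. Otherwise \<beta> stays nonzero when \<open>var t\<close> is set to zero, loses a
  variable, and regularity lifts from \<open>V - {t}\<close>, which still contains \<open>i\<close>
  and \<open>j\<close>.\<close>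

lemma free_regular:
  assumes "finite W" "restrict_vars W \<beta> = \<beta>" "i \<notin> W" "j \<notin> W" "\<beta> \<noteq> 0"
    and "finite V" "i \<in> V" "j \<in> V" "i \<noteq> j" "\<beta> * h \<in> I V"
  shows "h \<in> I V"
  using assms
proof (induction W arbitrary: \<beta> V h rule: finite_induct)
  case empty
  obtain c where "\<beta> = mconst c" using restrict_vars_empty[of \<beta>] empty.prems(1) by auto
  with empty.prems have "c \<noteq> 0" "mconst (1 / c) * (mconst c * h) \<in> I V"
    by (auto intro: gen2_mult_left)
  then show ?case by (simp add: mconst_mult_cancel)
next
  case (insert t W)
  from insert.prems show ?case
  proof (induction "degree (by_degree \<beta>)" arbitrary: \<beta> h rule: less_induct)
    case less
    have t: "t \<noteq> i" "t \<noteq> j" using less.prems by auto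
    have card: "card (V - {t}) \<ge> 2"
      using less.prems t by (intro card_Diff_singleton_ge_2[of V i j]) auto
    have cancel: "q \<in> I V" if "var t * q \<in> I V" for q
      using var_regular[OF less.prems(5) card that] .
    have fin: "finite V" by (fact less.prems(5))
    show ?case
    proof (cases "drop_var t \<beta> = 0")
      case True
      then obtain \<gamma> where \<gamma>: "\<beta> = var t * \<gamma>" by (auto simp: drop_var_eq_0_iff elim: dvdE)
      have "\<gamma> \<noteq> 0" using less.prems(4) \<gamma> by auto
      have "degree (by_degree \<beta>) = Suc (degree (by_degree \<gamma>))"
        using \<open>\<gamma> \<noteq> 0\<close> by (simp add: \<gamma> degree_mult_eq by_degree_eq_0_iff)
      moreover have "restrict_vars (insert t W) \<gamma> = \<gamma>"
        using less.prems(1) by (simp add: \<gamma>)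
      moreover have "\<gamma> * h \<in> I V"
        by (rule cancel) (use less.prems(9) in \<open>simp add: \<gamma> mult.assoc\<close>)
      ultimately show ?thesis
        using less.hyps[of \<gamma> h] less.prems \<open>\<gamma> \<noteq> 0\<close> by simp
    next
      case False
      have W: "restrict_vars W (drop_var t \<beta>) = drop_var t \<beta>"
      proof -
        have "drop_var t \<beta> = restrict_vars (- {t} \<inter> insert t W) \<beta>"
          using less.prems(1) by (metis drop_var_eq_restrict_vars restrict_vars_restrict_vars)
        also have "- {t} \<inter> insert t W = W" using insert.hyps by auto
        finally show ?thesis by (simp add: restrict_vars_restrict_vars)
      qed
      have "{h. \<beta> * h \<in> I V} \<subseteq> I V"
      proof (rule subset_gen2_by_dropping_var[where t = t and a = a and b = b])
        fix h u v assume "h \<in> {h. \<beta> * h \<in> I V}"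
        then have "\<beta> * h - \<beta> * (u * power_sum V a + v * power_sum V b) \<in> I V"
          by (intro gen2_diff gen2_mult_left[OF gen2I]) auto
        then show "h - (u * power_sum V a + v * power_sum V b) \<in> {h. \<beta> * h \<in> I V}"
          by (simp add: algebra_simps)
      next
        fix h assume "h \<in> {h. \<beta> * h \<in> I V}"
        then have "drop_var t (\<beta> * h) \<in> I (V - {t})" by (intro I_drop_var fin) auto
        then have "drop_var t \<beta> * drop_var t h \<in> I (V - {t})" by simp
        moreover have "finite (V - {t})" "i \<in> V - {t}" "j \<in> V - {t}" using less.prems t by auto
        moreover have "i \<notin> W" "j \<notin> W" using less.prems by auto
        ultimately have "drop_var t h \<in> I (V - {t})"
          using insert.IH[OF W _ _ False] less.prems(8) by blast
        then show "drop_var t h \<in> gen2 (drop_var t (power_sum V a)) (drop_var t (power_sum V b))"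
          using less.prems by (simp add: drop_var_power_sum a_pos b_pos)
      next
        fix h assume "var t * h \<in> {h. \<beta> * h \<in> I V}"
        then have "var t * (\<beta> * h) \<in> I V" by (simp add: ac_simps)
        then have "\<beta> * h \<in> I V" by (rule cancel)
        then show "h \<in> {h. \<beta> * h \<in> I V}" by simp
      qed (simp_all add: by_degree_power_sum)
      then show ?thesis using less.prems(9) by blast
    qed
  qed
qed

section \<open>Lifting primality by one variable\<close>

definition prime_I :: "nat set \<Rightarrow> bool" where
  "prime_I V \<longleftrightarrow> (\<forall>p q. p * q \<in> I V \<longrightarrow> p \<in> I V \<or> q \<in> I V)"

text \<open>The lifting principle is applied twice. First, a polynomial \<open>q\<close> with
  reduction outside the smaller ideal is shown to be regular modulo \<open>I V\<close>. Hence the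
  reductions of all zero divisors lie in the smaller ideal, and the principle puts the zero divisors
  themselves into \<open>I V\<close>.\<close>

lemma prime_I_remove:
  assumes fin: "finite V" and card: "card (V - {t}) \<ge> 2" and prime: "prime_I (V - {t})"
  shows "prime_I V"
proof -
  let ?f = "power_sum V a" and ?g = "power_sum V b"
  have drop: "gen2 (drop_var t ?f) (drop_var t ?g) = I (V - {t})"
    using fin by (simp add: drop_var_power_sum a_pos b_pos)
  have shift: "(h - (u * ?f + v * ?g)) * q \<in> I V" if "h * q \<in> I V" for h q u v
    using gen2_diff[OF that gen2_mult_right[OF gen2I, of u ?f v ?g q]] by (simp add: left_diff_distrib)
  have sub: "{p. p * q \<in> I V} \<subseteq> I V" if "drop_var t q \<notin> I (V - {t})" for q
  proof (rule subset_gen2_by_dropping_var[where t = t and a = a and b = b])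
    fix h assume "h \<in> {p. p * q \<in> I V}"
    then have "drop_var t (h * q) \<in> I (V - {t})" by (intro I_drop_var fin) auto
    then show "drop_var t h \<in> gen2 (drop_var t ?f) (drop_var t ?g)"
      using prime that unfolding drop prime_I_def by auto
  next
    fix h assume "var t * h \<in> {p. p * q \<in> I V}"
    then have "var t * (h * q) \<in> I V" by (simp add: ac_simps)
    then show "h \<in> {p. p * q \<in> I V}" using var_regular[OF fin card] by blast
  qed (use shift in \<open>simp_all add: by_degree_power_sum\<close>)
  \<comment> \<open>Second application, to the set of zero divisors modulo \<open>I V\<close>;
    \<open>sub\<close> supplies the condition on reductions.\<close>
  have "{q. \<exists>p. p \<notin> I V \<and> p * q \<in> I V} \<subseteq> I V"
  proof (rule subset_gen2_by_dropping_var[where t = t and a = a and b = b])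
    fix h u v assume "h \<in> {q. \<exists>p. p \<notin> I V \<and> p * q \<in> I V}"
    then show "h - (u * ?f + v * ?g) \<in> {q. \<exists>p. p \<notin> I V \<and> p * q \<in> I V}"
      using shift by (auto simp: mult.commute)
  next
    fix h assume "h \<in> {q. \<exists>p. p \<notin> I V \<and> p * q \<in> I V}"
    then show "drop_var t h \<in> gen2 (drop_var t ?f) (drop_var t ?g)"
      using sub[of h] unfolding drop by blast
  next
    fix h assume "var t * h \<in> {q. \<exists>p. p \<notin> I V \<and> p * q \<in> I V}"
    then obtain p where "p \<notin> I V" "var t * (p * h) \<in> I V" by (auto simp: ac_simps)
    then show "h \<in> {q. \<exists>p. p \<notin> I V \<and> p * q \<in> I V}" using var_regular[OF fin card] by blast
  qed (simp_all add: by_degree_power_sum)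
  then show ?thesis unfolding prime_I_def by blast
qed

end

section \<open>Simple roots over a subring\<close>

locale subring =
  fixes R :: "'a::idom set"
  assumes zero_mem [simp]: "0 \<in> R" and one_mem [simp]: "1 \<in> R"
    and add_mem: "x \<in> R \<Longrightarrow> y \<in> R \<Longrightarrow> x + y \<in> R"
    and uminus_mem: "x \<in> R \<Longrightarrow> - x \<in> R"
    and mult_mem: "x \<in> R \<Longrightarrow> y \<in> R \<Longrightarrow> x * y \<in> R"
begin

lemma diff_mem: "x \<in> R \<Longrightarrow> y \<in> R \<Longrightarrow> x - y \<in> R"
  using add_mem[of x "- y"] uminus_mem by simp

lemma sum_mem: "(\<And>k. k \<in> A \<Longrightarrow> c k \<in> R) \<Longrightarrow> sum c A \<in> R"
  by (induction A rule: infinite_finite_induct) (auto intro: add_mem)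

lemma power_mem: "x \<in> R \<Longrightarrow> x ^ k \<in> R"
  by (induction k) (auto intro: mult_mem)

definition polys :: "'a poly set" where
  "polys = {p. \<forall>k. coeff p k \<in> R}"

lemma subring_polys: "subring polys"
proof
  fix p q assume "p \<in> polys" "q \<in> polys"
  then show "p * q \<in> polys"
    by (auto simp: polys_def coeff_mult intro!: sum_mem mult_mem)
qed (auto simp: polys_def coeff_1 intro: add_mem uminus_mem)

lemma subring_adjoin: "subring ((\<lambda>p. poly p y) ` polys)"
proof -
  interpret P: subring polys by (rule subring_polys)
  show ?thesis
  proof
    show "0 \<in> (\<lambda>p. poly p y) ` polys" by (rule image_eqI[of _ _ 0]) auto
    show "1 \<in> (\<lambda>p. poly p y) ` polys" by (rule image_eqI[of _ _ 1]) auto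
  next
    fix u v assume "u \<in> (\<lambda>p. poly p y) ` polys" "v \<in> (\<lambda>p. poly p y) ` polys"
    then obtain p q where pq: "p \<in> polys" "q \<in> polys" "u = poly p y" "v = poly q y" by blast
    show "u + v \<in> (\<lambda>p. poly p y) ` polys"
      using pq P.add_mem by (intro image_eqI[of _ _ "p + q"]) auto
    show "u * v \<in> (\<lambda>p. poly p y) ` polys"
      using pq P.mult_mem by (intro image_eqI[of _ _ "p * q"]) auto
    show "- u \<in> (\<lambda>p. poly p y) ` polys"
      using pq P.uminus_mem by (intro image_eqI[of _ _ "- p"]) auto
  qed
qed

text \<open>Gaussian elimination by induction on the equations, with cross multiplication by the
  pivot in place of division, so that all coefficients stay in \<open>R\<close>.\<close>

lemma linear_dependence:
  assumes "finite E" "finite K" "card E < card K" "\<And>k x. r k x \<in> R"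
  shows "\<exists>c. (\<forall>k. c k \<in> R) \<and> (\<exists>k\<in>K. c k \<noteq> 0) \<and> (\<forall>x\<in>E. (\<Sum>k\<in>K. c k * r k x) = 0)"
  using assms
proof (induction E arbitrary: K r rule: finite_induct)
  case empty
  then have "K \<noteq> {}" by auto
  then show ?case by (intro exI[of _ "\<lambda>_. 1"]) auto
next
  case (insert e E)
  show ?case
  proof (cases "\<forall>k\<in>K. r k e = 0")
    case True
    obtain c where "\<forall>k. c k \<in> R" "\<exists>k\<in>K. c k \<noteq> 0" "\<forall>x\<in>E. (\<Sum>k\<in>K. c k * r k x) = 0"
      using insert.IH[of K r] insert.prems insert.hyps by auto
    then show ?thesis using True by (intro exI[of _ c]) simp
  next
    case False
    then obtain k0 where k0: "k0 \<in> K" "r k0 e \<noteq> 0" by blast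
    define K' where "K' = K - {k0}"
    define r' where "r' k x = r k0 e * r k x - r k e * r k0 x" for k x
    have "card E < card K'" using insert k0 by (simp add: K'_def card_Diff_singleton)
    moreover have "finite K'" using insert by (simp add: K'_def)
    moreover have "r' k x \<in> R" for k x
      using insert.prems(3) by (auto simp: r'_def intro!: diff_mem mult_mem)
    ultimately obtain c where c: "\<forall>k. c k \<in> R" "\<exists>k\<in>K'. c k \<noteq> 0" "\<forall>x\<in>E. (\<Sum>k\<in>K'. c k * r' k x) = 0"
      using insert.IH[of K' r'] by blast
    \<comment> \<open>Back substitution: the other unknowns are scaled by the pivot, and the value
      at \<open>k0\<close> is then forced by equation \<open>e\<close>.\<close>
    define d where "d k = (if k = k0 then - (\<Sum>k\<in>K'. c k * r k e) else r k0 e * c k)" for k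
    have split: "(\<Sum>k\<in>K. d k * r k x) =
        (\<Sum>k\<in>K'. r k0 e * c k * r k x) - (\<Sum>k\<in>K'. c k * r k e) * r k0 x" for x
    proof -
      have "(\<Sum>k\<in>K. d k * r k x) = d k0 * r k0 x + (\<Sum>k\<in>K'. d k * r k x)"
        using k0 insert.prems(1) by (simp add: K'_def sum.remove)
      also have "(\<Sum>k\<in>K'. d k * r k x) = (\<Sum>k\<in>K'. r k0 e * c k * r k x)"
        by (intro sum.cong) (auto simp: K'_def d_def)
      finally show ?thesis by (simp add: d_def)
    qed
    have "(\<Sum>k\<in>K. d k * r k x) = 0" if "x \<in> insert e E" for x
    proof (cases "x = e")
      case True
      then show ?thesis unfolding split by (simp add: sum_distrib_right sum_distrib_left ac_simps)
    next
      case False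
      then have "(\<Sum>k\<in>K'. c k * r' k x) = 0" using that c by simp
      then show ?thesis unfolding split
        by (simp add: r'_def sum_distrib_left sum_subtractf right_diff_distrib ac_simps)
    qed
    moreover have "d k \<in> R" for k
      using c(1) insert.prems(3) by (auto simp: d_def intro!: uminus_mem sum_mem mult_mem)
    moreover have "\<exists>k\<in>K. d k \<noteq> 0"
    proof -
      obtain k where "k \<in> K'" "c k \<noteq> 0" using c(2) by blast
      then show ?thesis using k0 by (intro bexI[of _ k]) (auto simp: K'_def d_def)
    qed
    ultimately show ?thesis by (intro exI[of _ d]) auto
  qed
qed

end

section \<open>Nilpotent and regular elements modulo an ideal\<close>

locale ring_ideal =
  fixes J :: "'a::comm_ring_1 set"
  assumes ideal_0: "0 \<in> J" and ideal_add: "p \<in> J \<Longrightarrow> q \<in> J \<Longrightarrow> p + q \<in> J"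
    and ideal_mult_left: "q \<in> J \<Longrightarrow> p * q \<in> J"
begin

lemma ideal_mult_right: "p \<in> J \<Longrightarrow> p * q \<in> J"
  using ideal_mult_left[of p q] by (simp add: mult.commute)

lemma ideal_uminus: "p \<in> J \<Longrightarrow> - p \<in> J"
  using ideal_mult_left[of p "- 1"] by simp

lemma ideal_diff: "p \<in> J \<Longrightarrow> q \<in> J \<Longrightarrow> p - q \<in> J"
  using ideal_add[of p "- q"] ideal_uminus by simp

lemma ideal_sum: "(\<And>x. x \<in> A \<Longrightarrow> c x \<in> J) \<Longrightarrow> sum c A \<in> J"
  by (induction A rule: infinite_finite_induct) (auto intro: ideal_add ideal_0)

lemma ideal_dvd: "p \<in> J \<Longrightarrow> p dvd q \<Longrightarrow> q \<in> J"
  by (auto elim!: dvdE intro: ideal_mult_right)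

lemma mem_cong: "p - q \<in> J \<Longrightarrow> p \<in> J \<longleftrightarrow> q \<in> J"
  using ideal_add[of "p - q" q] ideal_diff[of p "p - q"] by auto

lemma power_cong: "p - q \<in> J \<Longrightarrow> p ^ k - q ^ k \<in> J"
  using ideal_dvd diff_dvd_power_diff by blast

lemma poly_mem: "(\<And>k. coeff p k \<in> J) \<Longrightarrow> poly p y \<in> J"
  unfolding poly_altdef by (intro ideal_sum ideal_mult_right)

definition nilpotent :: "'a \<Rightarrow> bool" where
  "nilpotent p \<longleftrightarrow> (\<exists>k. p ^ k \<in> J)"

definition regular :: "'a \<Rightarrow> bool" where
  "regular p \<longleftrightarrow> (\<forall>q. p * q \<in> J \<longrightarrow> q \<in> J)"

lemma regular_mult: "regular p \<Longrightarrow> regular q \<Longrightarrow> regular (p * q)"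
  by (metis regular_def mult.assoc)

lemma regular_power: "regular p \<Longrightarrow> regular (p ^ k)"
proof (induction k)
  case (Suc k)
  then show ?case by (simp add: regular_mult)
qed (simp add: regular_def)

lemma regular_factor: "regular (p * q) \<Longrightarrow> regular p"
  unfolding regular_def by (metis mult.commute mult.left_commute ideal_mult_left)

lemma regular_cong: assumes "p - q \<in> J" shows "regular p \<longleftrightarrow> regular q"
proof -
  have "p * r - q * r \<in> J" for r using ideal_mult_right[OF assms, of r] by (simp add: algebra_simps)
  then show ?thesis unfolding regular_def using mem_cong by blast
qed

lemma nilpotent_mem: "p \<in> J \<Longrightarrow> nilpotent p"
  unfolding nilpotent_def by (intro exI[of _ 1]) simp

lemma nilpotent_mult: "nilpotent p \<Longrightarrow> nilpotent (q * p)"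
  unfolding nilpotent_def by (auto simp: power_mult_distrib intro: ideal_mult_left)

lemma nilpotent_add:
  assumes "nilpotent p" "nilpotent q" shows "nilpotent (p + q)"
proof -
  obtain k l where kl: "p ^ k \<in> J" "q ^ l \<in> J" using assms by (auto simp: nilpotent_def)
  have "(p + q) ^ (k + l) \<in> J"
    unfolding binomial_ring
  proof (rule ideal_sum)
    fix i assume i: "i \<in> {..k + l}"
    show "of_nat ((k + l) choose i) * p ^ i * q ^ (k + l - i) \<in> J"
    proof (cases "k \<le> i")
      case True
      then have "p ^ k dvd of_nat ((k + l) choose i) * p ^ i * q ^ (k + l - i)"
        by (intro dvd_mult2 dvd_mult le_imp_power_dvd)
      with kl(1) show ?thesis by (rule ideal_dvd)
    next
      case False
      then have "q ^ l dvd of_nat ((k + l) choose i) * p ^ i * q ^ (k + l - i)"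
        using i by (intro dvd_mult le_imp_power_dvd) auto
      with kl(2) show ?thesis by (rule ideal_dvd)
    qed
  qed
  then show ?thesis by (auto simp: nilpotent_def)
qed

lemma nilpotent_diff: "nilpotent p \<Longrightarrow> nilpotent q \<Longrightarrow> nilpotent (p - q)"
  using nilpotent_add[of p "- q"] nilpotent_mult[of q "- 1"] by simp

lemma regular_not_nilpotent: "regular p \<Longrightarrow> nilpotent p \<Longrightarrow> 1 \<in> J"
  unfolding nilpotent_def using regular_power[of p] by (metis mult.right_neutral regular_def)

end

text \<open>Multiplying by the leading coefficient of \<open>q\<close> at every step avoids division
  in \<open>R\<close>. The bound on the remainder is stated by coefficients, so that it means
  \<open>t = 0\<close> if \<open>q\<close> is constant.\<close>

lemma (in subring) pseudo_division:
  assumes q: "q \<in> polys" and p: "p \<in> polys"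
  shows "\<exists>N. \<exists>s\<in>polys. \<exists>t\<in>polys. smult (lead_coeff q ^ N) p = q * s + t \<and> (\<forall>k\<ge>degree q. coeff t k = 0)"
proof -
  interpret P: subring polys by (rule subring_polys)
  have monom: "monom c k \<in> polys" if "c \<in> R" for c k using that by (auto simp: polys_def)
  have smult: "smult c r \<in> polys" if "c \<in> R" "r \<in> polys" for c r
    using that by (auto simp: polys_def intro: mult_mem)
  have lc: "lead_coeff q \<in> R" using q by (auto simp: polys_def)
  have "\<exists>N. \<exists>s\<in>polys. \<exists>t\<in>polys. smult (lead_coeff q ^ N) p = q * s + t \<and> (\<forall>k\<ge>degree q. coeff t k = 0)"
    if "p \<in> polys" "\<And>k. k \<ge> n \<Longrightarrow> coeff p k = 0" for n p
    using that
  proof (induction n arbitrary: p)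
    case 0
    then have "p = 0" by (simp add: poly_eq_iff)
    then show ?case by (intro exI[of _ 0] bexI[of _ 0]) auto
  next
    case (Suc n)
    show ?case
    proof (cases "n < degree q")
      case True
      then have "\<forall>k\<ge>degree q. coeff p k = 0" by (auto intro!: Suc.prems(2))
      then show ?thesis using Suc.prems(1) by (intro exI[of _ 0] bexI[of _ 0] bexI[of _ p]) auto
    next
      case False
      define r where "r = monom (coeff p n) (n - degree q)"
      define p' where "p' = smult (lead_coeff q) p - r * q"
      have cn: "coeff p n \<in> R" using Suc.prems(1) by (simp add: polys_def)
      have r: "r \<in> polys" unfolding r_def by (rule monom[OF cn])
      have p': "p' \<in> polys" unfolding p'_def
        by (intro P.diff_mem P.mult_mem smult lc Suc.prems r q)
      have "coeff p' k = 0" if "k \<ge> n" for k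
      proof (cases "k = n")
        case True
        then show ?thesis using False by (simp add: p'_def r_def coeff_monom_mult)
      next
        case ne: False
        then have "k \<ge> Suc n" using that by simp
        then have "coeff p k = 0" "coeff q (k - (n - degree q)) = 0"
          using False by (simp_all add: Suc.prems(2) coeff_eq_0)
        then show ?thesis by (simp add: p'_def r_def coeff_monom_mult)
      qed
      then obtain N s t where st: "s \<in> polys" "t \<in> polys"
        "smult (lead_coeff q ^ N) p' = q * s + t" "\<forall>k\<ge>degree q. coeff t k = 0"
        using Suc.IH[OF p'] by blast
      have "smult (lead_coeff q ^ Suc N) p = smult (lead_coeff q ^ N) p' + q * smult (lead_coeff q ^ N) r"
        by (simp add: p'_def smult_diff_right mult.commute)
      also have "\<dots> = q * (s + smult (lead_coeff q ^ N) r) + t"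
        by (simp add: st(3) algebra_simps)
      finally show ?thesis
        using st r by (intro exI[of _ "Suc N"] bexI[of _ "s + smult (lead_coeff q ^ N) r"] bexI[of _ t])
          (auto intro!: P.add_mem smult power_mem lc)
    qed
  qed
  from this[OF p, of "Suc (degree p)"] show ?thesis by (simp add: coeff_eq_0)
qed

text \<open>Modulo \<open>J\<close> every element of the whole ring is nilpotent or regular, and
  elements of \<open>R\<close> are even zero or regular. Adjoining a simple root to \<open>R\<close>
  preserves the latter, so adjunctions can be iterated.\<close>

locale primary_ideal_over = ring_ideal J + subring R for J R :: "'a::idom set" +
  assumes proper: "1 \<notin> J"
    and primary: "\<And>p. nilpotent p \<or> regular p"
    and base: "\<And>r. r \<in> R \<Longrightarrow> r \<in> J \<or> regular r"
begin

text \<open>A nonzero polynomial \<open>q\<close> of least degree with \<open>q(y)\<close> nilpotent divides \<open>m\<close> up to a constant.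
  As \<open>m'(y)\<close> is regular, \<open>q(y) = 0\<close>; hence every nilpotent element of \<open>R[y]\<close> is zero.\<close>

lemma adjoin_simple_root:
  assumes m: "m \<in> polys" "poly m y \<in> J" "regular (poly (pderiv m) y)" and p: "p \<in> polys"
  shows "poly p y \<in> J \<or> regular (poly p y)"
proof -
  define bad where "bad q \<longleftrightarrow> q \<in> polys \<and> (\<exists>k. coeff q k \<notin> J) \<and> nilpotent (poly q y)" for q
  have good: "poly t y \<in> J" if "\<not> bad t" "t \<in> polys" "nilpotent (poly t y)" for t
    using that unfolding bad_def by (intro poly_mem) blast
  show ?thesis
  proof (cases "\<exists>q. bad q")
    case False
    then show ?thesis using good[of p] primary[of "poly p y"] p by blast
  next
    case True
    then obtain q where q: "bad q" and minimal: "\<And>t. bad t \<Longrightarrow> degree q \<le> degree t"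
      using ex_has_least_nat[of bad _ degree] by metis
    have qR: "q \<in> polys" and qnil: "nilpotent (poly q y)" using q by (auto simp: bad_def)
    define c where "c = lead_coeff q"
    \<comment> \<open>Otherwise the leading term could be dropped, leaving a bad polynomial of
      smaller degree.\<close>
    have "c \<notin> J"
    proof
      assume "c \<in> J"
      define t where "t = q - monom c (degree q)"
      obtain k where k: "coeff q k \<notin> J" using q by (auto simp: bad_def)
      have "k \<noteq> degree q" using k \<open>c \<in> J\<close> by (auto simp: c_def)
      moreover have "k \<le> degree q" using k ideal_0 by (metis coeff_eq_0 not_le)
      ultimately have "0 < degree q" by simp
      have coeff_t: "coeff t l = (if l = degree q then 0 else coeff q l)" for l
        by (auto simp: t_def c_def)
      have "degree t < degree q"
        using \<open>0 < degree q\<close> by (intro degree_lessI) (auto simp: coeff_t coeff_eq_0)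
      moreover have "bad t"
        unfolding bad_def
      proof (intro conjI)
        show "t \<in> polys" using qR by (auto simp: polys_def coeff_t)
        show "\<exists>k. coeff t k \<notin> J" using k \<open>k \<noteq> degree q\<close> by (intro exI[of _ k]) (simp add: coeff_t)
        have "nilpotent (c * y ^ degree q)" using \<open>c \<in> J\<close> by (intro nilpotent_mem ideal_mult_right)
        then show "nilpotent (poly t y)" using qnil by (simp add: t_def poly_monom nilpotent_diff)
      qed
      ultimately show False using minimal[of t] by simp
    qed
    moreover have "c \<in> R" using qR by (simp add: c_def polys_def)
    ultimately have c: "regular (c ^ N)" for N using base by (blast intro: regular_power)
    have rem: "\<not> bad t" if "\<forall>k\<ge>degree q. coeff t k = 0" for t
    proof
      assume t: "bad t"
      then obtain k where "coeff t k \<notin> J" by (auto simp: bad_def)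
      then have "coeff t k \<noteq> 0" using ideal_0 by metis
      then have "t \<noteq> 0" by auto
      then have "degree t < degree q" using that by (metis leading_coeff_0_iff not_le)
      then show False using minimal[OF t] by simp
    qed
    have qy: "poly q y \<in> J"
    proof (rule ccontr)
      assume ny: "poly q y \<notin> J"
      obtain N s t where st: "s \<in> polys" "t \<in> polys" "smult (c ^ N) m = q * s + t"
          "\<forall>k\<ge>degree q. coeff t k = 0"
        using pseudo_division[OF qR m(1)] by (auto simp: c_def)
      have "poly t y = c ^ N * poly m y - poly s y * poly q y"
        using arg_cong[OF st(3), of "\<lambda>r. poly r y"] by (simp add: algebra_simps)
      then have "nilpotent (poly t y)"
        using m(2) qnil by (simp add: nilpotent_diff nilpotent_mult nilpotent_mem ideal_mult_left)
      then have tJ: "coeff t k \<in> J" for k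
        using rem[OF st(4)] st(2) by (auto simp: bad_def)
      have "poly q y * poly s y = c ^ N * poly m y - poly t y"
        using arg_cong[OF st(3), of "\<lambda>r. poly r y"] by (simp add: algebra_simps)
      then have "poly s y * poly q y \<in> J"
        using m(2) tJ by (simp add: mult.commute ideal_diff ideal_mult_right poly_mem)
      then have snil: "nilpotent (poly s y)"
        using ny primary[of "poly s y"] unfolding regular_def by blast
      \<comment> \<open>Both \<open>poly q y\<close> and \<open>poly s y\<close> are now nilpotent.
        Differentiating \<open>smult (c ^ N) m = q * s + t\<close> makes the derivative of
        \<open>m\<close> at \<open>y\<close> nilpotent up to the regular factor
        \<open>c ^ N\<close>.\<close>
      have "poly (pderiv t) y \<in> J"
        using tJ by (intro poly_mem) (simp add: coeff_pderiv ideal_mult_left del: of_nat_Suc)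
      moreover have "c ^ N * poly (pderiv m) y =
          poly (pderiv q) y * poly s y + poly (pderiv s) y * poly q y + poly (pderiv t) y"
        using arg_cong[OF st(3), of "\<lambda>r. poly (pderiv r) y"]
        by (simp add: pderiv_smult pderiv_add pderiv_mult algebra_simps)
      ultimately have "nilpotent (c ^ N * poly (pderiv m) y)"
        using snil qnil by (simp add: nilpotent_add nilpotent_mult nilpotent_mem)
      then show False
        using regular_not_nilpotent[OF regular_mult[OF c m(3)]] proper by blast
    qed
    show ?thesis
    proof (cases "nilpotent (poly p y)")
      case True
      \<comment> \<open>The remainder of \<open>p\<close> by \<open>q\<close> has a nilpotent value
        and too small a degree to be bad, so its value lies in \<open>J\<close>.\<close>
      obtain N s t where st: "s \<in> polys" "t \<in> polys" "smult (c ^ N) p = q * s + t"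
          "\<forall>k\<ge>degree q. coeff t k = 0"
        using pseudo_division[OF qR p] by (auto simp: c_def)
      have eq: "c ^ N * poly p y = poly s y * poly q y + poly t y"
        using arg_cong[OF st(3), of "\<lambda>r. poly r y"] by (simp add: algebra_simps)
      then have "poly t y = c ^ N * poly p y - poly s y * poly q y" by simp
      then have "nilpotent (poly t y)"
        using True qnil by (simp add: nilpotent_diff nilpotent_mult)
      then have "poly t y \<in> J" using good rem[OF st(4)] st(2) by blast
      then have "c ^ N * poly p y \<in> J" unfolding eq by (intro ideal_add ideal_mult_left qy)
      then show ?thesis using c unfolding regular_def by blast
    next
      case False
      then show ?thesis using primary by blast
    qed
  qed
qed

end

section \<open>Algebraicity over the remaining variables\<close>

text \<open>The base ring \<open>B\<close>, with \<open>x\<close> and \<open>y\<close> the variables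
  of index \<open>i\<close> and \<open>j\<close>. It also contains all variables outside
  \<open>V\<close>.\<close>

definition free2 :: "nat \<Rightarrow> nat \<Rightarrow> mpoly set" where
  "free2 i j = {\<beta>. drop_var i \<beta> = \<beta> \<and> drop_var j \<beta> = \<beta>}"

interpretation free2: subring "free2 i j" for i j
  by unfold_locales (auto simp: free2_def)

lemma mconst_free2: "mconst c \<in> free2 i j" and var_free2: "s \<noteq> i \<Longrightarrow> s \<noteq> j \<Longrightarrow> var s \<in> free2 i j"
  by (simp_all add: free2_def drop_var_var)

lemma power_sum_free2: "i \<notin> W \<Longrightarrow> j \<notin> W \<Longrightarrow> power_sum W d \<in> free2 i j"
  unfolding power_sum_def
  by (intro free2.sum_mem free2.power_mem var_free2) auto

lemma power_sum_split:
  assumes "finite V" "i \<in> V" "j \<in> V" "i \<noteq> j"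
  shows "power_sum V d = var i ^ d + var j ^ d + power_sum (V - {i, j}) d"
proof -
  have "V = insert i (insert j (V - {i, j}))" using assms by auto
  then have "power_sum V d = (\<Sum>k\<in>insert i (insert j (V - {i, j})). var k ^ d)"
    by (simp add: power_sum_def)
  then show ?thesis using assms by (simp add: power_sum_def add.assoc)
qed

interpretation gen2: ring_ideal "gen2 f g" for f g
  by unfold_locales (auto intro: gen2_add gen2_mult_left)

section \<open>Elimination of one of two variables\<close>

lemma
  fixes c :: "'a::idom"
  assumes "d > 0"
  shows degree_const_minus_monom: "degree ([:c:] - monom 1 d) = d"
    and lead_coeff_const_minus_monom: "lead_coeff ([:c:] - monom 1 d) = - 1"
proof -
  have "coeff ([:c:] - monom 1 d) d = - 1"
    using assms by (simp add: coeff_pCons split: nat.splits)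
  moreover have "coeff ([:c:] - monom 1 d) k = 0" if "k > d" for k
    using that by (simp add: coeff_pCons split: nat.splits)
  ultimately show "degree ([:c:] - monom 1 d) = d"
    by (metis (no_types, lifting) antisym degree_le le_degree neg_equal_0_iff_equal one_neq_zero)
  then show "lead_coeff ([:c:] - monom 1 d) = - 1"
    using \<open>coeff ([:c:] - monom 1 d) d = - 1\<close> by simp
qed

lemma
  fixes c :: "'a::idom"
  assumes "d > 0"
  shows coeff_const_minus_monom_power: "coeff (([:c:] - monom 1 d) ^ e) (d * e) = (- 1) ^ e"
    and degree_const_minus_monom_power: "degree (([:c:] - monom 1 d) ^ e) = d * e"
proof -
  have "[:c:] - monom 1 d \<noteq> 0" using lead_coeff_const_minus_monom[OF assms, of c] by auto
  then show deg: "degree (([:c:] - monom 1 d) ^ e) = d * e"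
    by (simp add: degree_power_eq degree_const_minus_monom[OF assms] mult.commute)
  show "coeff (([:c:] - monom 1 d) ^ e) (d * e) = (- 1) ^ e"
    using lead_coeff_power[of "[:c:] - monom 1 d" e]
    by (simp only: deg lead_coeff_const_minus_monom[OF assms])
qed

context power_sum_pair
begin

text \<open>Eliminating \<open>y\<close> from \<open>x^a + y^a + s\<^sub>a = 0 = x^b + y^b + s\<^sub>b\<close> by \<open>(y^a)^b = (y^b)^a\<close>.\<close>

definition elim_poly :: "nat set \<Rightarrow> mpoly poly" where
  "elim_poly W = ([:- power_sum W a:] - monom 1 a) ^ b - ([:- power_sum W b:] - monom 1 b) ^ a"

text \<open>Both powers have degree \<open>a * b\<close>, with top coefficients
  \<open>(- 1) ^ b\<close> and \<open>(- 1) ^ a\<close>.\<close>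

lemma elim_poly_coeff: "coeff (elim_poly W) (a * b) \<in> {2, - 2}"
  using sign_diff[where 'a = mpoly] coeff_const_minus_monom_power[OF a_pos, of "- power_sum W a" b]
    coeff_const_minus_monom_power[OF b_pos, of "- power_sum W b" a]
  by (simp add: elim_poly_def mult.commute)

lemma elim_poly_degree: "degree (elim_poly W) \<le> a * b"
  unfolding elim_poly_def
  by (rule degree_diff_le)
     (simp_all only: degree_const_minus_monom_power a_pos b_pos mult.commute[of b a] order_refl)

lemma elim_poly_free2:
  assumes "i \<notin> W" "j \<notin> W"
  shows "elim_poly W \<in> free2.polys i j"
proof -
  interpret P: subring "free2.polys i j" by (rule free2.subring_polys)
  have *: "[:- power_sum W d:] - monom 1 d \<in> free2.polys i j" for d
    using assms power_sum_free2[of i W j d]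
    by (auto simp: free2.polys_def coeff_pCons split: nat.splits
        intro!: free2.diff_mem free2.uminus_mem)
  show ?thesis unfolding elim_poly_def by (rule P.diff_mem[OF P.power_mem[OF *] P.power_mem[OF *]])
qed

context
  fixes V :: "nat set" and i j :: nat
  assumes V: "finite V" "i \<in> V" "j \<in> V" "i \<noteq> j"
begin

text \<open>Modulo \<open>I V\<close> the base of the first power is just
  \<open>var j ^ d\<close>.\<close>

lemma minus_power_sum_cong:
  assumes "d \<in> {a, b}"
  shows "(- power_sum (V - {i, j}) d - var i ^ d) ^ e - var j ^ (d * e) \<in> I V"
proof -
  have "power_sum V d \<in> I V" using assms by auto
  moreover have "- power_sum (V - {i, j}) d - var i ^ d - var j ^ d = - power_sum V d"
    using power_sum_split[OF V, of d] by simp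
  ultimately have "- power_sum (V - {i, j}) d - var i ^ d - var j ^ d \<in> I V"
    by (simp only: gen2_uminus)
  from gen2.power_cong[OF this, of e] show ?thesis by (simp add: power_mult)
qed

lemma elim_poly_root: "poly (elim_poly (V - {i, j})) (var i) \<in> I V"
proof -
  have "((- power_sum (V - {i, j}) a - var i ^ a) ^ b - var j ^ (a * b))
      - ((- power_sum (V - {i, j}) b - var i ^ b) ^ a - var j ^ (b * a)) \<in> I V"
    by (intro gen2_diff minus_power_sum_cong) auto
  then show ?thesis by (simp add: elim_poly_def poly_monom mult.commute)
qed

text \<open>Both inner powers may be replaced by powers of \<open>var j\<close>. Up to sign and
  powers of the variables, the result is the Jacobian minor for \<open>i\<close> and
  \<open>j\<close>.\<close>

lemma elim_poly_deriv:
  "poly (pderiv (elim_poly (V - {i, j}))) (var i)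
    - of_nat (a * b) * (var i ^ (a - 1) * var j ^ (a * b - b) * (var i ^ (b - a) - var j ^ (b - a))) \<in> I V"
proof -
  define u where "u = (- power_sum (V - {i, j}) a - var i ^ a) ^ (b - 1)"
  define v where "v = (- power_sum (V - {i, j}) b - var i ^ b) ^ (a - 1)"
  have uv: "u - var j ^ (a * (b - 1)) \<in> I V" "v - var j ^ (b * (a - 1)) \<in> I V"
    unfolding u_def v_def by (rule minus_power_sum_cong; simp)+
  have "a * (b - 1) = (a * b - b) + (b - a)"
    using a_pos a_less_b by (cases a) (simp_all add: diff_mult_distrib2)
  moreover have "b * (a - 1) = a * b - b" "b - 1 = (a - 1) + (b - a)"
    using a_pos a_less_b by (simp_all add: diff_mult_distrib2 mult.commute)
  ultimately have e: "var j ^ (a * (b - 1)) = var j ^ (a * b - b) * var j ^ (b - a)"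
      "var j ^ (b * (a - 1)) = var j ^ (a * b - b)" "var i ^ (b - 1) = var i ^ (a - 1) * var i ^ (b - a)"
    by (simp_all only: power_add)
  have "poly (pderiv (elim_poly (V - {i, j}))) (var i) =
      of_nat (a * b) * (var i ^ (b - 1) * v - var i ^ (a - 1) * u)"
    by (simp add: elim_poly_def pderiv_diff pderiv_power pderiv_monom pderiv_pCons poly_monom u_def v_def
        algebra_simps)
  moreover have "of_nat (a * b) * (var i ^ (b - 1) * (v - var j ^ (b * (a - 1)))
      - var i ^ (a - 1) * (u - var j ^ (a * (b - 1)))) \<in> I V"
    by (intro gen2_mult_left gen2_diff uv)
  moreover have "of_nat (a * b) * (var i ^ (b - 1) * (v - var j ^ (b * (a - 1)))
      - var i ^ (a - 1) * (u - var j ^ (a * (b - 1)))) =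
     of_nat (a * b) * (var i ^ (b - 1) * v - var i ^ (a - 1) * u)
      - of_nat (a * b) * (var i ^ (a - 1) * var j ^ (a * b - b) * (var i ^ (b - a) - var j ^ (b - a)))"
    unfolding e by (simp only: algebra_simps)
  ultimately show ?thesis by simp
qed

text \<open>Divide the elimination polynomial by its top coefficient, which is a unit. Thus
  \<open>var i\<close> is integral over the base ring.\<close>

lemma var_power_reduce:
  "\<exists>c. (\<forall>k. c k \<in> free2 i j) \<and> var i ^ (a * b) - (\<Sum>k<a * b. c k * var i ^ k) \<in> I V"
proof -
  let ?m = "elim_poly (V - {i, j})"
  have "\<exists>e. mconst e * coeff ?m (a * b) = 1"
    using elim_poly_coeff[of "V - {i, j}"]
  proof (elim insertE emptyE)
    assume "coeff ?m (a * b) = 2"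
    then show ?thesis using mconst_half by metis
  next
    assume "coeff ?m (a * b) = - 2"
    then show ?thesis using mconst_half
      by (intro exI[of _ "- (1/2)"]) (simp only: mconst_uminus minus_mult_minus)
  qed
  then obtain e where e: "mconst e * coeff ?m (a * b) = 1" by blast
  define c where "c k = - (mconst e * coeff ?m k)" for k
  have "coeff ?m k \<in> free2 i j" for k
    using elim_poly_free2[of i "V - {i, j}" j] by (simp add: free2.polys_def)
  then have "c k \<in> free2 i j" for k
    unfolding c_def by (intro free2.uminus_mem free2.mult_mem mconst_free2)
  moreover have "poly ?m (var i) = (\<Sum>k<Suc (a * b). coeff ?m k * var i ^ k)"
    unfolding poly_altdef using elim_poly_degree[of "V - {i, j}"]
    by (intro sum.mono_neutral_left) (auto simp: coeff_eq_0)
  then have "mconst e * poly ?m (var i) =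
      (\<Sum>k<a * b. mconst e * coeff ?m k * var i ^ k) + mconst e * coeff ?m (a * b) * var i ^ (a * b)"
    by (simp only: sum.lessThan_Suc distrib_left sum_distrib_left mult.assoc)
  then have "mconst e * poly ?m (var i) = var i ^ (a * b) - (\<Sum>k<a * b. c k * var i ^ k)"
    by (simp add: e c_def sum_negf)
  then have "var i ^ (a * b) - (\<Sum>k<a * b. c k * var i ^ k) \<in> I V"
    using gen2_mult_left[OF elim_poly_root, of "mconst e"] by simp
  ultimately show ?thesis by (intro exI[of _ c]) simp
qed

end

text \<open>The module over the base ring generated, modulo \<open>I V\<close>, by the monomials in
  \<open>var i\<close> and \<open>var j\<close> with both exponents below \<open>a * b\<close>. The
  index \<open>e\<close> is the pair of exponents.\<close>

definition span :: "nat set \<Rightarrow> nat \<Rightarrow> nat \<Rightarrow> mpoly set" where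
  "span V i j = {p. \<exists>c. (\<forall>e. c e \<in> free2 i j) \<and>
     p - (\<Sum>e\<in>{..<a * b} \<times> {..<a * b}. c e * (var i ^ fst e * var j ^ snd e)) \<in> I V}"

lemma span_gen:
  assumes "k < a * b" "l < a * b"
  shows "var i ^ k * var j ^ l \<in> span V i j"
proof -
  define c :: "nat \<times> nat \<Rightarrow> mpoly" where "c e = (if e = (k, l) then 1 else 0)" for e
  have "(\<Sum>e\<in>{..<a * b} \<times> {..<a * b}. c e * (var i ^ fst e * var j ^ snd e)) =
      (\<Sum>e\<in>{(k, l)}. c e * (var i ^ fst e * var j ^ snd e))"
    using assms by (intro sum.mono_neutral_right) (auto simp: c_def)
  then have "var i ^ k * var j ^ l
      - (\<Sum>e\<in>{..<a * b} \<times> {..<a * b}. c e * (var i ^ fst e * var j ^ snd e)) \<in> I V"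
    by (simp add: c_def)
  moreover have "\<forall>e. c e \<in> free2 i j" by (simp add: c_def)
  ultimately show ?thesis unfolding span_def by blast
qed

lemma span_add:
  assumes "p \<in> span V i j" "q \<in> span V i j" shows "p + q \<in> span V i j"
proof -
  let ?E = "{..<a * b} \<times> {..<a * b}" and ?x = "\<lambda>e. var i ^ fst e * var j ^ snd e"
  obtain c d where c: "\<forall>e. c e \<in> free2 i j" "p - (\<Sum>e\<in>?E. c e * ?x e) \<in> I V"
    and d: "\<forall>e. d e \<in> free2 i j" "q - (\<Sum>e\<in>?E. d e * ?x e) \<in> I V"
    using assms unfolding span_def by blast
  have "(p - (\<Sum>e\<in>?E. c e * ?x e)) + (q - (\<Sum>e\<in>?E. d e * ?x e)) \<in> I V"
    by (intro gen2_add c d)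
  also have "(p - (\<Sum>e\<in>?E. c e * ?x e)) + (q - (\<Sum>e\<in>?E. d e * ?x e))
      = (p + q) - (\<Sum>e\<in>?E. (c e + d e) * ?x e)"
    by (simp add: sum.distrib distrib_right)
  finally show ?thesis
    unfolding span_def using c d by (intro CollectI exI[of _ "\<lambda>e. c e + d e"]) (auto intro: free2.add_mem)
qed

lemma span_scale:
  assumes "p \<in> span V i j" "\<beta> \<in> free2 i j" shows "\<beta> * p \<in> span V i j"
proof -
  let ?E = "{..<a * b} \<times> {..<a * b}" and ?x = "\<lambda>e. var i ^ fst e * var j ^ snd e"
  obtain c where c: "\<forall>e. c e \<in> free2 i j" "p - (\<Sum>e\<in>?E. c e * ?x e) \<in> I V"
    using assms unfolding span_def by blast
  have "\<beta> * (p - (\<Sum>e\<in>?E. c e * ?x e)) \<in> I V" by (intro gen2_mult_left c)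
  also have "\<beta> * (p - (\<Sum>e\<in>?E. c e * ?x e)) = \<beta> * p - (\<Sum>e\<in>?E. (\<beta> * c e) * ?x e)"
    by (simp add: right_diff_distrib sum_distrib_left mult.assoc)
  finally show ?thesis
    unfolding span_def using c assms(2)
    by (intro CollectI exI[of _ "\<lambda>e. \<beta> * c e"]) (auto intro: free2.mult_mem)
qed

lemma span_ideal: "p \<in> I V \<Longrightarrow> p \<in> span V i j"
  unfolding span_def by (intro CollectI exI[of _ "\<lambda>_. 0"]) simp

lemma span_sum: "(\<And>x. x \<in> A \<Longrightarrow> h x \<in> span V i j) \<Longrightarrow> sum h A \<in> span V i j"
  by (induction A rule: infinite_finite_induct) (auto intro: span_add span_ideal)

lemma span_cong: "p - q \<in> I V \<Longrightarrow> q \<in> span V i j \<Longrightarrow> p \<in> span V i j"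
  using span_add[of "p - q" V i j q] span_ideal[of "p - q" V i j] by simp

lemma span_closed:
  assumes p: "p \<in> span V i j"
    and gens: "\<And>k l. k < a * b \<Longrightarrow> l < a * b \<Longrightarrow> q * (var i ^ k * var j ^ l) \<in> span V i j"
  shows "q * p \<in> span V i j"
proof -
  let ?E = "{..<a * b} \<times> {..<a * b}" and ?x = "\<lambda>e. var i ^ fst e * var j ^ snd e"
  obtain c where c: "\<forall>e. c e \<in> free2 i j" "p - (\<Sum>e\<in>?E. c e * ?x e) \<in> I V"
    using p unfolding span_def by blast
  have "c e * (q * ?x e) \<in> span V i j" if "e \<in> ?E" for e
    using that c(1) by (intro span_scale gens) auto
  then have "(\<Sum>e\<in>?E. c e * (q * ?x e)) \<in> span V i j" by (rule span_sum)
  moreover have "q * (p - (\<Sum>e\<in>?E. c e * ?x e)) \<in> I V" by (intro gen2_mult_left c)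
  then have "q * p - (\<Sum>e\<in>?E. c e * (q * ?x e)) \<in> I V"
    by (simp add: right_diff_distrib sum_distrib_left ac_simps)
  ultimately show ?thesis by (rule span_cong[rotated])
qed

lemma free2_commute: "free2 i j = free2 j i"
  by (auto simp: free2_def)

text \<open>As 1 lies in the span, stability under multiplication by each variable suffices. An
  exponent raised to \<open>a * b\<close> is brought down by \<open>var_power_reduce\<close>;
  variables other than the two chosen ones are scalars.\<close>

lemma span_UNIV:
  assumes V: "finite V" "i \<in> V" "j \<in> V" "i \<noteq> j"
  shows "p \<in> span V i j"
proof -
  have V': "finite V" "j \<in> V" "i \<in> V" "j \<noteq> i" using V by auto
  have M: "0 < a * b" using a_pos b_pos by simp
  have vi: "var i * (var i ^ k * var j ^ l) \<in> span V i j" if "k < a * b" "l < a * b" for k l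
  proof (cases "Suc k < a * b")
    case True
    then show ?thesis using span_gen[of "Suc k" l i j V] that by (simp add: ac_simps)
  next
    case False
    then have "Suc k = a * b" using that by simp
    obtain c where c: "\<forall>k. c k \<in> free2 i j" "var i ^ (a * b) - (\<Sum>k<a * b. c k * var i ^ k) \<in> I V"
      using var_power_reduce[OF V] by blast
    have "(\<Sum>k<a * b. c k * (var i ^ k * var j ^ l)) \<in> span V i j"
      using c that by (intro span_sum span_scale span_gen) auto
    moreover have pow: "var i ^ (a * b) = var i * var i ^ k" by (simp flip: \<open>Suc k = a * b\<close>)
    have "(var i ^ (a * b) - (\<Sum>k<a * b. c k * var i ^ k)) * var j ^ l \<in> I V"
      by (intro gen2_mult_right c)
    then have "var i * (var i ^ k * var j ^ l) - (\<Sum>k<a * b. c k * (var i ^ k * var j ^ l)) \<in> I V"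
      by (simp only: pow left_diff_distrib sum_distrib_right mult.assoc)
    ultimately show ?thesis by (rule span_cong[rotated])
  qed
  have vj: "var j * (var i ^ k * var j ^ l) \<in> span V i j" if "k < a * b" "l < a * b" for k l
  proof (cases "Suc l < a * b")
    case True
    then show ?thesis using span_gen[of k "Suc l" i j V] that by (simp add: ac_simps)
  next
    case False
    then have "Suc l = a * b" using that by simp
    obtain c where c: "\<forall>k. c k \<in> free2 i j" "var j ^ (a * b) - (\<Sum>k<a * b. c k * var j ^ k) \<in> I V"
      using var_power_reduce[OF V'] unfolding free2_commute[of j i] by blast
    have "(\<Sum>l<a * b. c l * (var i ^ k * var j ^ l)) \<in> span V i j"
      using c that by (intro span_sum span_scale span_gen) auto
    moreover have pow: "var j ^ (a * b) = var j * var j ^ l" by (simp flip: \<open>Suc l = a * b\<close>)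
    have "var i ^ k * (var j ^ (a * b) - (\<Sum>k<a * b. c k * var j ^ k)) \<in> I V"
      by (intro gen2_mult_left c)
    then have "var j * (var i ^ k * var j ^ l) - (\<Sum>l<a * b. c l * (var i ^ k * var j ^ l)) \<in> I V"
      by (simp only: pow right_diff_distrib sum_distrib_left ac_simps)
    ultimately show ?thesis by (rule span_cong[rotated])
  qed
  have "\<forall>q\<in>span V i j. p * q \<in> span V i j"
  proof (induction p rule: mpoly_induct)
    case (var s)
    show ?case
    proof (cases "s = i \<or> s = j")
      case True
      then show ?thesis using vi vj span_closed by auto
    next
      case False
      then show ?thesis using span_scale var_free2 by auto
    qed
  qed (auto simp: span_scale mconst_free2 distrib_right span_add mult.assoc)
  moreover have "1 \<in> span V i j" using span_gen[OF M M, of i j V]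
    by (metis span_gen M power_0 mult_1)
  ultimately show ?thesis by (metis mult.right_neutral)
qed

text \<open>There is one more power of \<open>h\<close> in play than there are generators of
  \<open>span V i j\<close>, so these powers satisfy a nontrivial linear relation over the base
  ring.\<close>

lemma algebraic:
  assumes V: "finite V" "i \<in> V" "j \<in> V" "i \<noteq> j"
  shows "\<exists>g\<in>free2.polys i j. g \<noteq> 0 \<and> poly g h \<in> I V"
proof -
  let ?E = "{..<a * b} \<times> {..<a * b}" and ?x = "\<lambda>e. var i ^ fst e * var j ^ snd e"
  define K where "K = {..card ?E}"
  have "\<forall>k. \<exists>c. (\<forall>e. c e \<in> free2 i j) \<and> h ^ k - (\<Sum>e\<in>?E. c e * ?x e) \<in> I V"
    using span_UNIV[OF V, of "h ^ _"] unfolding span_def by blast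
  then obtain r where "\<forall>k. (\<forall>e. r k e \<in> free2 i j) \<and> h ^ k - (\<Sum>e\<in>?E. r k e * ?x e) \<in> I V"
    by (rule choice[THEN exE])
  then have r: "\<And>k e. r k e \<in> free2 i j" "\<And>k. h ^ k - (\<Sum>e\<in>?E. r k e * ?x e) \<in> I V"
    by blast+
  obtain c where c: "\<forall>k. c k \<in> free2 i j" "\<exists>k\<in>K. c k \<noteq> 0" "\<forall>e\<in>?E. (\<Sum>k\<in>K. c k * r k e) = 0"
  proof -
    have "finite ?E" "finite K" "card ?E < card K" unfolding K_def by (simp_all only: finite_cartesian_product finite_lessThan finite_atMost card_atMost lessI)
    from free2.linear_dependence[where r = r, OF this r(1)] show ?thesis using that by blast
  qed
  define g where "g = (\<Sum>k\<in>K. monom (c k) k)"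
  have coeff_g: "coeff g k = (if k \<in> K then c k else 0)" for k
    by (simp add: g_def coeff_sum K_def)
  have "poly g h = (\<Sum>k\<in>K. c k * h ^ k)" by (simp add: g_def poly_sum poly_monom)
  also have "\<dots> = (\<Sum>k\<in>K. c k * (h ^ k - (\<Sum>e\<in>?E. r k e * ?x e))) + (\<Sum>k\<in>K. \<Sum>e\<in>?E. c k * r k e * ?x e)"
    by (simp add: right_diff_distrib sum_subtractf sum_distrib_left mult.assoc)
  also have "(\<Sum>k\<in>K. \<Sum>e\<in>?E. c k * r k e * ?x e) = (\<Sum>e\<in>?E. (\<Sum>k\<in>K. c k * r k e) * ?x e)"
    unfolding sum_distrib_right by (rule sum.swap)
  also have "\<dots> = 0" using c(3) by (intro sum.neutral ballI) (simp only: mult_zero_left)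
  finally have "poly g h \<in> I V"
    using r(2) by (simp add: gen2.ideal_sum gen2_mult_left)
  moreover have "g \<noteq> 0" using c(2) coeff_g by (metis coeff_0)
  moreover have "g \<in> free2.polys i j" using c(1) by (simp add: free2.polys_def coeff_g)
  ultimately show ?thesis by blast
qed

end

section \<open>Jacobian derivations\<close>

lemma pdiff_mconst [simp]: "pdiff k (mconst c) = 0"
  and pdiff_add [simp]: "pdiff k (p + q) = pdiff k p + pdiff k q"
  and pdiff_diff: "pdiff k (p - q) = pdiff k p - pdiff k q"
  and pdiff_mult: "pdiff k (p * q) = p * pdiff k q + q * pdiff k p"
  by (simp_all add: pdiff_def pderiv_pCons pderiv_add pderiv_diff pderiv_mult poly_in_var)

lemma pdiff_0 [simp]: "pdiff k 0 = 0" and pdiff_1 [simp]: "pdiff k 1 = 0"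
  by (simp_all add: pdiff_def)

lemma pdiff_var: "pdiff k (var s) = (if s = k then 1 else 0)"
  by (simp add: pdiff_def in_var_var pderiv_pCons)

lemma pdiff_sum: "pdiff k (sum h A) = (\<Sum>x\<in>A. pdiff k (h x))"
  by (induction A rule: infinite_finite_induct) auto

lemma in_var_pdiff: "in_var k (pdiff k p) = pderiv (in_var k p)"
  by (induction p rule: mpoly_induct)
     (auto simp: pdiff_mult pdiff_var in_var_var pderiv_pCons pderiv_add pderiv_mult)

lemma restrict_vars_pdiff: "k \<in> A \<Longrightarrow> restrict_vars A (pdiff k p) = pdiff k (restrict_vars A p)"
  by (induction p rule: mpoly_induct) (auto simp: pdiff_mult pdiff_var)

lemma in_var_drop_var: "in_var k (drop_var k p) = [:drop_var k p:]"
  by (induction p rule: mpoly_induct) (auto simp: drop_var_var in_var_var)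

lemma pdiff_free: "drop_var k p = p \<Longrightarrow> pdiff k p = 0"
  using in_var_drop_var[of k p] by (simp add: pdiff_def pderiv_pCons)

lemma pdiff_var_power: "pdiff k (var s ^ d) = (if s = k then of_nat d * var k ^ (d - 1) else 0)"
proof (induction d)
  case (Suc d)
  then show ?case by (cases d) (auto simp: pdiff_mult pdiff_var algebra_simps)
qed simp

lemma pdiff_power_sum:
  assumes "finite V" "k \<in> V"
  shows "pdiff k (power_sum V d) = of_nat d * var k ^ (d - 1)"
  using assms by (simp add: power_sum_def pdiff_sum pdiff_var_power)

text \<open>Modulo \<open>J\<close> the fraction \<open>\<alpha> / \<beta>\<close> is idempotent, hence killed by \<open>D\<close>, so applying \<open>D\<close> to
  \<open>\<gamma> (\<alpha> / \<beta>) = \<rho>\<close> gives \<open>D \<gamma> (\<alpha> / \<beta>) = D \<rho>\<close>.\<close>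

lemma (in ring_ideal) transporter_derivation:
  assumes D_diff: "\<And>p q. D (p - q) = D p - D q" and D_mult: "\<And>p q. D (p * q) = p * D q + q * D p"
    and D_J: "\<And>p. p \<in> J \<Longrightarrow> D p \<in> J"
    and \<beta>: "regular \<beta>" and \<alpha>: "\<alpha> * \<alpha> - \<alpha> * \<beta> \<in> J" and \<gamma>: "\<gamma> * \<alpha> - \<beta> * \<rho> \<in> J"
  shows "D \<gamma> * \<alpha> - \<beta> * D \<rho> \<in> J"
proof -
  define e where "e = \<alpha> * \<alpha> - \<alpha> * \<beta>"
  define \<kappa> where "\<kappa> = \<gamma> * \<alpha> - \<beta> * \<rho>"
  have e: "e \<in> J" and De: "D e \<in> J" and \<kappa>: "\<kappa> \<in> J" and D\<kappa>: "D \<kappa> \<in> J"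
    using \<alpha> \<gamma> D_J by (auto simp: e_def \<kappa>_def)
  have De_eq: "D e = 2 * \<alpha> * D \<alpha> - (\<alpha> * D \<beta> + \<beta> * D \<alpha>)"
    by (simp add: e_def D_diff D_mult)
  have D\<kappa>_eq: "D \<kappa> = \<gamma> * D \<alpha> + \<alpha> * D \<gamma> - (\<beta> * D \<rho> + \<rho> * D \<beta>)"
    by (simp add: \<kappa>_def D_diff D_mult)
  \<comment> \<open>The numerator of the derivative of the fraction. The factor
    \<open>2 * \<alpha> - \<beta>\<close> works because its square is
    \<open>\<beta> * \<beta> + 4 * e\<close>, just as \<open>2 * \<epsilon> - 1\<close> has square 1
    for an idempotent \<epsilon>.\<close>
  have "\<beta> * (\<beta> * D \<alpha> - \<alpha> * D \<beta>) = (2 * \<alpha> - \<beta>) * D e - 4 * D \<alpha> * e + 2 * D \<beta> * e"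
    unfolding De_eq by (simp add: e_def algebra_simps)
  also have "\<dots> \<in> J" by (intro ideal_add ideal_diff ideal_mult_left e De)
  finally have 1: "\<beta> * D \<alpha> - \<alpha> * D \<beta> \<in> J" using \<beta> unfolding regular_def by blast
  have "\<beta> * (D \<gamma> * \<alpha> - \<beta> * D \<rho>) = \<beta> * D \<kappa> - \<gamma> * (\<beta> * D \<alpha> - \<alpha> * D \<beta>) - D \<beta> * \<kappa>"
    unfolding D\<kappa>_eq by (simp add: \<kappa>_def algebra_simps)
  also have "\<dots> \<in> J" by (intro ideal_diff ideal_mult_left 1 \<kappa> D\<kappa>)
  finally show ?thesis using \<beta> unfolding regular_def by blast
qed

context
  fixes f g :: mpoly
begin

definition minor :: "nat \<Rightarrow> nat \<Rightarrow> mpoly" where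
  "minor i j = pdiff i f * pdiff j g - pdiff j f * pdiff i g"

text \<open>The determinant of the Jacobian matrix of \<open>f\<close>, \<open>g\<close>,
  \<open>h\<close> in three variables, expanded along the row of \<open>h\<close>. It vanishes for
  \<open>h = f\<close> and \<open>h = g\<close> because of equal rows.\<close>

definition jacobian :: "nat \<Rightarrow> nat \<Rightarrow> nat \<Rightarrow> mpoly \<Rightarrow> mpoly" where
  "jacobian i j k h = minor i j * pdiff k h + minor j k * pdiff i h + minor k i * pdiff j h"

lemma jacobian_add: "jacobian i j k (p + q) = jacobian i j k p + jacobian i j k q"
  and jacobian_diff: "jacobian i j k (p - q) = jacobian i j k p - jacobian i j k q"
  and jacobian_mult: "jacobian i j k (p * q) = p * jacobian i j k q + q * jacobian i j k p"
  by (simp_all add: jacobian_def pdiff_diff pdiff_mult algebra_simps)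

lemma jacobian_gen2:
  assumes "p \<in> gen2 f g" shows "jacobian i j k p \<in> gen2 f g"
proof -
  obtain u v where p: "p = u * f + v * g" using assms by (rule gen2E)
  have "jacobian i j k f = 0" "jacobian i j k g = 0"
    by (simp_all add: jacobian_def minor_def algebra_simps)
  then have "jacobian i j k p = jacobian i j k u * f + jacobian i j k v * g"
    by (simp add: p jacobian_add jacobian_mult mult.commute)
  then show ?thesis by (metis gen2I)
qed

text \<open>On polynomials free of \<open>x\<^sub>i, x\<^sub>j\<close> the derivation \<open>jacobian i j k\<close> is \<open>minor i j\<close> times
  \<open>\<partial>/\<partial>x\<^sub>k\<close>, so repeated differentiation lowers the degree at the price of powers of the minor.\<close>

lemma minor_power_mem:
  assumes "ring_ideal T" and stable: "\<And>k \<gamma>. \<gamma> \<in> T \<Longrightarrow> jacobian i j k \<gamma> \<in> T"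
    and "finite W" "restrict_vars W \<beta> = \<beta>" "i \<notin> W" "j \<notin> W" "\<beta> \<noteq> 0" "\<beta> * minor i j ^ e \<in> T"
  shows "\<exists>N. minor i j ^ N \<in> T"
  using assms(3-)
proof (induction W arbitrary: \<beta> e rule: finite_induct)
  case empty
  interpret T: ring_ideal T by fact
  obtain c where c: "\<beta> = mconst c" using restrict_vars_empty[of \<beta>] empty.prems(1) by auto
  then have "c \<noteq> 0" using empty.prems by auto
  then have "minor i j ^ e \<in> T"
    using T.ideal_mult_left[OF empty.prems(5), of "mconst (1 / c)"] by (simp add: c mconst_mult_cancel)
  then show ?case by blast
next
  case (insert k W)
  interpret T: ring_ideal T by fact
  define \<delta> where "\<delta> = minor i j"
  from insert.prems show ?case
  proof (induction "degree (in_var k \<beta>)" arbitrary: \<beta> e rule: less_induct)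
    case less
    show ?case
    proof (cases "degree (in_var k \<beta>) = 0")
      case True
      then obtain c where c: "in_var k \<beta> = [:c:]" by (rule degree_eq_zeroE)
      then have "drop_var k \<beta> = \<beta>" using poly_in_var[of k \<beta>] by (simp add: drop_var_def)
      then have "\<beta> = restrict_vars (- {k} \<inter> insert k W) \<beta>"
        using less.prems(1) by (metis drop_var_eq_restrict_vars restrict_vars_restrict_vars)
      also have "- {k} \<inter> insert k W = W" using insert.hyps by auto
      finally show ?thesis using insert.IH[of \<beta> e] less.prems by simp
    next
      case False
      have free: "drop_var s \<beta> = \<beta>" if "s \<notin> insert k W" for s
      proof -
        have "drop_var s \<beta> = restrict_vars (- {s} \<inter> insert k W) \<beta>"
          using less.prems(1) by (metis drop_var_eq_restrict_vars restrict_vars_restrict_vars)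
        also have "- {s} \<inter> insert k W = insert k W" using that by auto
        finally show ?thesis using less.prems(1) by simp
      qed
      have J\<beta>: "jacobian i j k \<beta> = \<delta> * pdiff k \<beta>"
        using less.prems free[of i] free[of j] by (simp add: jacobian_def \<delta>_def pdiff_free)
      \<comment> \<open>The extra factor \<delta> avoids the exponent \<open>m - 1\<close>, which
        would be truncated at \<open>m = 0\<close>.\<close>
      have J\<delta>: "\<delta> * jacobian i j k (\<delta> ^ m) = of_nat m * (\<delta> ^ m * jacobian i j k \<delta>)" for m
      proof (induction m)
        case 0
        show ?case by (simp add: jacobian_def)
      next
        case (Suc m)
        have "\<delta> * jacobian i j k (\<delta> ^ Suc m) = \<delta> * (\<delta> * jacobian i j k (\<delta> ^ m)) + \<delta> ^ Suc m * jacobian i j k \<delta>"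
          by (simp add: jacobian_mult algebra_simps)
        also have "\<dots> = of_nat (Suc m) * (\<delta> ^ Suc m * jacobian i j k \<delta>)"
          unfolding Suc by (simp add: algebra_simps)
        finally show ?case .
      qed
      \<comment> \<open>After multiplication by \<delta>, the summand in which
        \<open>\<delta> ^ e\<close> is differentiated becomes a multiple of
        \<open>\<beta> * \<delta> ^ e\<close>. Removing it leaves the derivative of \<beta>, at the
        cost of two more factors \<delta>.\<close>
      have "pdiff k \<beta> * \<delta> ^ (e + 2) =
          \<delta> * jacobian i j k (\<beta> * \<delta> ^ e) - (of_nat e * jacobian i j k \<delta>) * (\<beta> * \<delta> ^ e)"
      proof -
        have "\<delta> * jacobian i j k (\<beta> * \<delta> ^ e) = \<beta> * (\<delta> * jacobian i j k (\<delta> ^ e)) + \<delta> ^ (e + 2) * pdiff k \<beta>"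
          by (simp add: jacobian_mult J\<beta> algebra_simps)
        then show ?thesis unfolding J\<delta> by (simp add: algebra_simps)
      qed
      also have "\<dots> \<in> T"
        unfolding \<delta>_def
        by (rule T.ideal_diff[OF T.ideal_mult_left[OF stable] T.ideal_mult_left]; fact less.prems(5))
      finally have "pdiff k \<beta> * minor i j ^ (e + 2) \<in> T" by (simp add: \<delta>_def)
      moreover have "degree (in_var k (pdiff k \<beta>)) < degree (in_var k \<beta>)"
        using False by (simp add: in_var_pdiff degree_pderiv)
      moreover have "pdiff k \<beta> \<noteq> 0"
        using False in_var_pdiff[of k \<beta>] by (auto simp: pderiv_eq_0_iff)
      moreover have "restrict_vars (insert k W) (pdiff k \<beta>) = pdiff k \<beta>"
        using less.prems(1) by (simp add: restrict_vars_pdiff)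
      ultimately show ?thesis
        using less.hyps[of "pdiff k \<beta>" "e + 2"] less.prems by blast
    qed
  qed
qed

end

section \<open>The common zeros of the minors\<close>

text \<open>By Zorn's lemma take \<open>P\<close> maximal among the ideals above \<open>J\<close>
  that contain no power of \<open>x\<close>. If \<open>p\<close> and \<open>q\<close> lie outside
  \<open>P\<close>, enlarging \<open>P\<close> by either yields a power of \<open>x\<close>, and
  multiplying the two shows \<open>p * q \<notin> P\<close>. Such a \<open>P\<close> stands in for a
  point of the zero set at which \<open>x\<close> does not vanish.\<close>

lemma (in ring_ideal) prime_avoiding_powers:
  assumes avoid: "\<And>N. x ^ N \<notin> J"
  obtains P where "ring_ideal P" "J \<subseteq> P" "x \<notin> P" "\<And>p q. p * q \<in> P \<Longrightarrow> p \<in> P \<or> q \<in> P"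
proof -
  define \<A> where "\<A> = {P. ring_ideal P \<and> J \<subseteq> P \<and> (\<forall>N. x ^ N \<notin> P)}"
  have "J \<in> \<A>" using avoid ring_ideal_axioms by (simp add: \<A>_def)
  moreover have "\<Union>\<C> \<in> \<A>" if \<C>: "\<C> \<noteq> {}" "subset.chain \<A> \<C>" for \<C>
  proof -
    have mem: "P \<in> \<A>" if "P \<in> \<C>" for P using that \<C>(2) by (auto simp: subset.chain_def)
    have "ring_ideal (\<Union>\<C>)"
    proof
      show "0 \<in> \<Union>\<C>" using \<C>(1) mem by (auto simp: \<A>_def ring_ideal_def)
    next
      fix p q assume "p \<in> \<Union>\<C>" "q \<in> \<Union>\<C>"
      then obtain P Q where "P \<in> \<C>" "Q \<in> \<C>" "p \<in> P" "q \<in> Q" by blast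
      moreover have "P \<subseteq> Q \<or> Q \<subseteq> P" using \<C>(2) \<open>P \<in> \<C>\<close> \<open>Q \<in> \<C>\<close> by (auto simp: subset.chain_def)
      ultimately obtain U where "U \<in> \<C>" "p \<in> U" "q \<in> U" by blast
      then show "p + q \<in> \<Union>\<C>" using mem[of U] by (auto simp: \<A>_def ring_ideal_def)
    next
      fix p q assume "q \<in> \<Union>\<C>"
      then show "p * q \<in> \<Union>\<C>" using mem by (fastforce simp: \<A>_def ring_ideal_def)
    qed
    then show ?thesis using \<C>(1) mem by (auto simp: \<A>_def)
  qed
  ultimately obtain P where P: "P \<in> \<A>" and maximal: "\<And>Q. Q \<in> \<A> \<Longrightarrow> P \<subseteq> Q \<Longrightarrow> Q = P"
    using subset_Zorn_nonempty[of \<A>] by blast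
  interpret P: ring_ideal P using P by (simp add: \<A>_def)
  have power: "\<exists>N r. x ^ N - r * p \<in> P" if "p \<notin> P" for p
  proof -
    \<comment> \<open>The ideal generated by \<open>P\<close> and \<open>p\<close>.\<close>
    define Q where "Q = {q. \<exists>r. q - r * p \<in> P}"
    have "ring_ideal Q"
    proof
      show "0 \<in> Q" unfolding Q_def by (intro CollectI exI[of _ 0]) (simp add: P.ideal_0)
    next
      fix u v assume "u \<in> Q" "v \<in> Q"
      then obtain r s where "u - r * p \<in> P" "v - s * p \<in> P" by (auto simp: Q_def)
      then have "(u - r * p) + (v - s * p) \<in> P" by (rule P.ideal_add)
      then show "u + v \<in> Q" unfolding Q_def by (intro CollectI exI[of _ "r + s"]) (simp add: algebra_simps)
    next
      fix u v assume "v \<in> Q"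
      then obtain r where "v - r * p \<in> P" by (auto simp: Q_def)
      then have "u * (v - r * p) \<in> P" by (rule P.ideal_mult_left)
      then show "u * v \<in> Q" unfolding Q_def by (intro CollectI exI[of _ "u * r"]) (simp add: algebra_simps)
    qed
    moreover have "P \<subseteq> Q" unfolding Q_def by (intro subsetI CollectI exI[of _ 0]) simp
    moreover have "p \<in> Q" unfolding Q_def by (intro CollectI exI[of _ 1]) (simp add: P.ideal_0)
    ultimately have "Q \<notin> \<A>" "J \<subseteq> Q" using maximal[of Q] that P by (auto simp: \<A>_def)
    then show ?thesis using \<open>ring_ideal Q\<close> by (auto simp: \<A>_def Q_def)
  qed
  have "p \<in> P \<or> q \<in> P" if pq: "p * q \<in> P" for p q
  proof (rule ccontr)
    assume "\<not> (p \<in> P \<or> q \<in> P)"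
    then obtain M r N s where rs: "x ^ M - r * p \<in> P" "x ^ N - s * q \<in> P" using power by blast
    have "x ^ (M + N) = (x ^ M - r * p) * x ^ N + r * p * (x ^ N - s * q) + r * s * (p * q)"
      by (simp add: power_add algebra_simps)
    also have "\<dots> \<in> P"
      by (intro P.ideal_add P.ideal_mult_right[OF rs(1)] P.ideal_mult_left[OF rs(2)] P.ideal_mult_left[OF pq])
    finally show False using P by (simp add: \<A>_def)
  qed
  moreover have "x \<notin> P" "J \<subseteq> P" using P unfolding \<A>_def by (auto dest: spec[of _ 1])
  ultimately show ?thesis using that P.ring_ideal_axioms by blast
qed

lemma mconst_power: "mconst c ^ k = mconst (c ^ k)"
  by (induction k) (simp_all add: mconst_mult)

lemma mconst_sum: "mconst (sum c A) = (\<Sum>x\<in>A. mconst (c x))"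
  by (induction A rule: infinite_finite_induct) (simp_all add: mconst_add)

lemma mconst_of_nat: "mconst (of_nat k) = of_nat k"
  by (simp add: mconst_def)

lemma mconst_eq_iff: "mconst c = mconst d \<longleftrightarrow> c = d"
  by (metis mconst_def lookup_single_eq)

text \<open>With \<open>x\<close> replaced by an unknown, both sides are monic of degree
  \<open>n\<close> and share the \<open>n\<close> roots \<open>mconst \<zeta> * w\<close>. These are
  distinct for \<open>w \<noteq> 0\<close>.\<close>

lemma prod_roots_of_unity:
  fixes x w :: mpoly
  assumes "n > 0"
  shows "(\<Prod>\<zeta>\<in>{\<zeta>. \<zeta> ^ n = 1}. x - mconst \<zeta> * w) = x ^ n - w ^ n"
proof (cases "w = 0")
  case True
  then show ?thesis using assms by (simp add: card_roots_unity_eq zero_power)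
next
  case False
  define A where "A = {\<zeta>::complex. \<zeta> ^ n = 1}"
  have A: "finite A" "card A = n" using assms by (simp_all add: A_def finite_roots_unity card_roots_unity_eq)
  define q where "q = (\<Prod>\<zeta>\<in>A. [:- (mconst \<zeta> * w), 1:])"
  define r where "r = monom 1 n - [:w ^ n:]"
  have deg: "degree q = n" unfolding q_def using A
    by (subst degree_prod_eq_sum_degree) auto
  moreover have "lead_coeff q = 1" by (simp add: q_def lead_coeff_prod)
  ultimately have "coeff q n = 1" by simp
  then have "coeff (q - r) k = 0" if "k \<ge> n" for k
    using that assms deg by (cases "k = n") (auto simp: r_def coeff_eq_0 coeff_pCons split: nat.splits)
  then have less: "degree (q - r) < n" if "q \<noteq> r"
    using that assms by (intro degree_lessI) auto
  have inj: "inj_on (\<lambda>\<zeta>. mconst \<zeta> * w) A"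
  proof (rule inj_onI)
    fix \<zeta> \<xi> assume "mconst \<zeta> * w = mconst \<xi> * w"
    then have "mconst \<zeta> = mconst \<xi>" using False by simp
    then show "\<zeta> = \<xi>" by (simp only: mconst_eq_iff)
  qed
  have roots: "(\<lambda>\<zeta>. mconst \<zeta> * w) ` A \<subseteq> {y. poly (q - r) y = 0}"
  proof clarify
    fix \<zeta> assume \<zeta>: "\<zeta> \<in> A"
    have "poly r (mconst \<zeta> * w) = 0"
      using \<zeta> by (simp add: r_def poly_monom power_mult_distrib A_def mconst_power)
    moreover have "poly q (mconst \<zeta> * w) = 0"
      using \<zeta> A by (auto simp: q_def poly_prod)
    ultimately show "poly (q - r) (mconst \<zeta> * w) = 0" by simp
  qed
  have "q = r"
  proof (rule ccontr)
    assume ne: "q \<noteq> r"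
    then have "finite {y. poly (q - r) y = 0}" by (intro poly_roots_finite) simp
    from card_mono[OF this roots] have "n \<le> card {y. poly (q - r) y = 0}"
      by (simp add: card_image[OF inj] A)
    also have "\<dots> \<le> degree (q - r)" using ne by (intro card_poly_roots_bound) simp
    finally show False using less[OF ne] by simp
  qed
  then have "poly q x = poly r x" by simp
  then show ?thesis by (simp add: q_def r_def poly_prod poly_monom A_def)
qed

section \<open>Sums of at most four roots of unity\<close>

lemma cnj_root_of_unity:
  assumes "\<zeta> ^ n = 1" "n > 0" shows "cnj \<zeta> = inverse \<zeta>"
proof -
  have "norm \<zeta> ^ n = 1" using assms(1) by (metis norm_one norm_power)
  then have "norm \<zeta> = 1" using power_eq_imp_eq_base[of "norm \<zeta>" n 1] assms(2) by simp
  then have "\<zeta> * cnj \<zeta> = 1" by (simp add: complex_norm_square[symmetric])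
  then show ?thesis by (metis inverse_unique)
qed

context
  fixes n :: nat
  assumes n: "odd n" "\<not> 3 dvd n"
begin

lemma n_pos: "n > 0" using n(1) by (rule odd_pos)

lemma two_roots_sum_neq_0:
  assumes "u ^ n = (1::complex)" "v ^ n = 1" shows "u + v \<noteq> 0"
proof
  assume "u + v = 0"
  then have "u = - v" by (simp add: eq_neg_iff_add_eq_0)
  then show False using assms n(1) by simp
qed

text \<open>Conjugating a vanishing sum makes the sum of the inverses vanish as well. The two
  relations force \<open>u / v\<close> to satisfy \<open>r * r + r + 1 = 0\<close>, so it is a cube
  root of unity other than 1; this contradicts \<open>\<not> 3 dvd n\<close>.\<close>

lemma three_roots_sum_neq_0:
  assumes "u ^ n = (1::complex)" "v ^ n = 1" "w ^ n = 1" shows "u + v + w \<noteq> 0"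
proof
  assume sum: "u + v + w = 0"
  have nz: "u \<noteq> 0" "v \<noteq> 0" "w \<noteq> 0" using assms n_pos by (auto simp: power_0_left)
  have "inverse u + inverse v + inverse w = 0"
    using arg_cong[OF sum, of cnj] assms n_pos by (simp add: cnj_root_of_unity)
  then have e2: "v * w + u * w + u * v = 0" using nz by (simp add: field_simps)
  have w: "w = - u - v" using sum by (simp add: algebra_simps eq_neg_iff_add_eq_0)
  have "u * u + u * v + v * v = - (v * w + u * w + u * v)" unfolding w by (simp add: algebra_simps)
  then have q: "u * u + u * v + v * v = 0" unfolding e2 by simp
  define r where "r = u / v"
  have r2: "r * r + r + 1 = 0" using q nz by (simp add: r_def field_simps)
  have "r ^ 3 - 1 = (r - 1) * (r * r + r + 1)" by (simp add: power3_eq_cube algebra_simps)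
  then have r3: "r ^ 3 = 1" using r2 by simp
  have rn: "r ^ n = 1" using assms by (simp add: r_def power_divide)
  have "r ^ n = (r ^ 3) ^ (n div 3) * r ^ (n mod 3)"
    by (metis mult_div_mod_eq power_add power_mult)
  then have rm: "r ^ (n mod 3) = 1" using rn r3 by simp
  have "n mod 3 = 1 \<or> n mod 3 = 2" using n(2) by presburger
  then have "r = 1"
  proof
    assume "n mod 3 = 2"
    then have "r * r = 1" using rm by (simp add: power2_eq_square)
    then show "r = 1" using r3 by (simp add: power3_eq_cube)
  qed (use rm in simp)
  then show False using r2 by simp
qed

text \<open>Together with the conjugate relation, a vanishing sum yields
  \<open>w * t = u * v\<close> and then \<open>(w + u) * (w + v) = 0\<close>. Two of the roots would
  be opposite, which odd \<open>n\<close> forbids.\<close>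

lemma four_roots_sum_neq_0:
  assumes "u ^ n = (1::complex)" "v ^ n = 1" "w ^ n = 1" "t ^ n = 1" shows "u + v + w + t \<noteq> 0"
proof
  assume sum: "u + v + w + t = 0"
  have nz: "u \<noteq> 0" "v \<noteq> 0" "w \<noteq> 0" "t \<noteq> 0" using assms n_pos by (auto simp: power_0_left)
  have "inverse u + inverse v + inverse w + inverse t = 0"
    using arg_cong[OF sum, of cnj] assms n_pos by (simp add: cnj_root_of_unity)
  then have e3: "(u + v) * (w * t) + (w + t) * (u * v) = 0" using nz by (simp add: field_simps)
  have "(w + t) + (u + v) = 0" using sum by (simp only: add_ac)
  then have "w + t = - (u + v)" by (simp only: eq_neg_iff_add_eq_0)
  then have "(u + v) * (w * t - u * v) = (u + v) * (w * t) + (w + t) * (u * v)"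
    by (simp only: right_diff_distrib mult_minus_left add_uminus_conv_diff)
  then have "(u + v) * (w * t - u * v) = 0" unfolding e3 .
  then have wt: "w * t = u * v" using two_roots_sum_neq_0[OF assms(1,2)] by simp
  have t: "t = - u - v - w" using sum by (simp add: algebra_simps eq_neg_iff_add_eq_0)
  have "(w + u) * (w + v) = u * v - w * t" unfolding t by (simp add: algebra_simps)
  then have "(w + u) * (w + v) = 0" unfolding wt by simp
  then show False using two_roots_sum_neq_0 assms by auto
qed

lemma sum_roots_neq_0:
  fixes c :: "nat \<Rightarrow> complex"
  assumes "finite V" "card V \<le> 4" "\<And>s. s \<in> V \<Longrightarrow> c s = 0 \<or> c s ^ n = 1" "w \<in> V" "c w \<noteq> 0"
  shows "(\<Sum>s\<in>V. c s) \<noteq> 0"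
proof -
  define U where "U = {s \<in> V. c s \<noteq> 0}"
  have "(\<Sum>s\<in>V. c s) = (\<Sum>s\<in>U. c s)"
    using assms(1) by (intro sum.mono_neutral_right) (auto simp: U_def)
  moreover have U: "\<And>s. s \<in> U \<Longrightarrow> c s ^ n = 1" using assms(3) by (auto simp: U_def)
  have finU: "finite U" and "w \<in> U" "card U \<le> 4"
    using assms card_mono[of V U] by (auto simp: U_def)
  then have "card U \<noteq> 0" by auto
  with \<open>card U \<le> 4\<close> consider "card U = 1" | "card U = 2" | "card U = 3" | "card U = Suc 3" by fastforce
  then have "(\<Sum>s\<in>U. c s) \<noteq> 0"
  proof cases
    case 1
    then obtain x where "U = {x}" by (auto simp: card_1_singleton_iff)
    then show ?thesis by (auto simp: U_def)
  next
    case 2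
    then obtain x y where "U = {x, y}" "x \<noteq> y" by (auto simp: card_2_iff)
    then show ?thesis using two_roots_sum_neq_0[of "c x" "c y"] U by simp
  next
    case 3
    then obtain x y z where "U = {x, y, z}" "x \<noteq> y" "y \<noteq> z" "x \<noteq> z" by (auto simp: card_3_iff)
    then show ?thesis using three_roots_sum_neq_0[of "c x" "c y" "c z"] U by (simp add: add.assoc)
  next
    case 4
    then obtain s U' where "U = insert s U'" "s \<notin> U'" "card U' = 3" by (metis card_Suc_eq)
    moreover then obtain x y z where "U' = {x, y, z}" "x \<noteq> y" "y \<noteq> z" "x \<noteq> z" by (auto simp: card_3_iff)
    ultimately show ?thesis using four_roots_sum_neq_0[of "c s" "c x" "c y" "c z"] U by (simp add: add.assoc)
  qed
  ultimately show ?thesis by simp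
qed

end

context power_sum_pair
begin

abbreviation "pminor V \<equiv> minor (power_sum V a) (power_sum V b)"

lemma pminor_eq:
  assumes "finite V" "i \<in> V" "j \<in> V"
  shows "pminor V i j = of_nat (a * b) * (var i ^ (a - 1) * var j ^ (a - 1) * (var j ^ (b - a) - var i ^ (b - a)))"
proof -
  have "b - 1 = (a - 1) + (b - a)" using a_pos a_less_b by simp
  then show ?thesis
    using assms by (simp add: minor_def pdiff_power_sum power_add algebra_simps)
qed

text \<open>Otherwise some prime \<open>P\<close> above \<open>T\<close> avoids
  \<open>var w\<close>. It contains the minors, so modulo \<open>P\<close> all variables are
  multiples of \<open>var w\<close> by zero or by roots of unity. The first power sum then yields a
  vanishing sum of at most four roots of unity.\<close>

lemma var_power_mem:
  assumes "ring_ideal T" and sub: "I V \<subseteq> T" and V: "finite V" "card V \<le> 4" and w: "w \<in> V"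
    and minors: "\<And>i j. i \<in> V \<Longrightarrow> j \<in> V \<Longrightarrow> i \<noteq> j \<Longrightarrow> \<exists>N. pminor V i j ^ N \<in> T"
  shows "\<exists>N. var w ^ N \<in> T"
proof (rule ccontr)
  interpret T: ring_ideal T by fact
  assume "\<nexists>N. var w ^ N \<in> T"
  then obtain P where P: "ring_ideal P" "T \<subseteq> P" "var w \<notin> P" and prime: "\<And>p q. p * q \<in> P \<Longrightarrow> p \<in> P \<or> q \<in> P"
    using T.prime_avoiding_powers[of "var w"] by blast
  interpret P: ring_ideal P by fact
  have one: "1 \<notin> P" using P.ideal_mult_left[of 1 "var w"] P(3) by auto
  have const: "c = 0" if "mconst c \<in> P" for c
  proof (rule ccontr)
    assume "c \<noteq> 0"
    then show False using P.ideal_mult_left[OF that, of "mconst (1 / c)"] mconst_mult_cancel[of c 1] one by simp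
  qed
  have power: "p \<in> P" if "p ^ k \<in> P" for p k
    using that by (induction k) (use one prime in auto)
  \<comment> \<open>The last conjunct provides a nonzero term in the sum formed below.\<close>
  have ex: "\<exists>\<zeta>. (\<zeta> = 0 \<or> \<zeta> ^ (b - a) = 1) \<and> var s - mconst \<zeta> * var w \<in> P \<and> (s = w \<longrightarrow> \<zeta> \<noteq> 0)"
    if s: "s \<in> V" for s
  proof (cases "s = w")
    case True
    then show ?thesis by (intro exI[of _ 1]) (simp add: P.ideal_0)
  next
    case False
    show ?thesis
    proof (cases "var s \<in> P")
      case True
      then show ?thesis using False by (intro exI[of _ 0]) simp
    next
      case ns: False
      obtain N where "pminor V w s ^ N \<in> T" using minors[OF w s] False by blast
      then have "pminor V w s \<in> P" using P(2) power by blast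
      moreover have "of_nat (a * b) \<notin> P"
        using const[of "of_nat (a * b)"] a_pos b_pos unfolding mconst_of_nat of_nat_eq_0_iff by auto
      moreover have "var s ^ (a - 1) \<notin> P" "var w ^ (a - 1) \<notin> P" using power ns P(3) by blast+
      ultimately have "var s ^ (b - a) - var w ^ (b - a) \<in> P"
        unfolding pminor_eq[OF V(1) w s] using prime by blast
      \<comment> \<open>The difference of powers splits into linear factors, one of which lies in
        the prime \<open>P\<close>.\<close>
      then have "(\<Prod>\<zeta>\<in>{\<zeta>. \<zeta> ^ (b - a) = 1}. var s - mconst \<zeta> * var w) \<in> P"
        using a_less_b by (simp add: prod_roots_of_unity)
      moreover have "\<exists>\<zeta>\<in>A. var s - mconst \<zeta> * var w \<in> P"
        if "(\<Prod>\<zeta>\<in>A. var s - mconst \<zeta> * var w) \<in> P" for A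
        using that
      proof (induction A rule: infinite_finite_induct)
        case (insert \<zeta> A)
        then show ?case using prime[of "var s - mconst \<zeta> * var w" "\<Prod>\<zeta>\<in>A. var s - mconst \<zeta> * var w"] by auto
      qed (use one in auto)
      ultimately show ?thesis using False by blast
    qed
  qed
  define c where "c s = (SOME \<zeta>. (\<zeta> = 0 \<or> \<zeta> ^ (b - a) = 1) \<and> var s - mconst \<zeta> * var w \<in> P \<and> (s = w \<longrightarrow> \<zeta> \<noteq> 0))" for s
  have c: "c s = 0 \<or> c s ^ (b - a) = 1" "var s - mconst (c s) * var w \<in> P" "s = w \<longrightarrow> c s \<noteq> 0" if "s \<in> V" for s
    using someI_ex[OF ex[OF that]] unfolding c_def by blast+
  have "(\<Sum>s\<in>V. var s ^ a - (mconst (c s) * var w) ^ a) \<in> P"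
    by (intro P.ideal_sum P.power_cong c)
  moreover have "power_sum V a \<in> P" using sub P(2) gen2_left by blast
  ultimately have "power_sum V a - (\<Sum>s\<in>V. var s ^ a - (mconst (c s) * var w) ^ a) \<in> P"
    by (intro P.ideal_diff)
  also have "power_sum V a - (\<Sum>s\<in>V. var s ^ a - (mconst (c s) * var w) ^ a) = mconst (\<Sum>s\<in>V. c s ^ a) * var w ^ a"
    by (simp add: power_sum_def sum_subtractf power_mult_distrib mconst_sum mconst_power sum_distrib_right)
  finally have "(\<Sum>s\<in>V. c s ^ a) = 0"
    using prime power P(3) const by blast
  moreover have "(\<Sum>s\<in>V. c s ^ a) \<noteq> 0"
  proof (rule sum_roots_neq_0[OF odd_diff not_3_dvd_diff V _ w])
    show "c s ^ a = 0 \<or> (c s ^ a) ^ (b - a) = 1" if "s \<in> V" for s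
      using c(1)[OF that] a_pos
      by (metis power_mult mult.commute power_one zero_power)
    show "c w ^ a \<noteq> 0" using c(3)[OF w] by simp
  qed
  ultimately show False by simp
qed

end

section \<open>Primality\<close>

lemma coeff_by_degree_0: "coeff (by_degree p) 0 = restrict_vars {} p"
  by (induction p rule: mpoly_induct) (auto simp: coeff_mult)

lemma components_gen2:
  assumes f: "by_degree f = monom f a" and g: "by_degree g = monom g b" and p: "p \<in> gen2 f g"
  shows "coeff (by_degree p) d \<in> gen2 f g"
proof -
  obtain u v where p: "p = u * f + v * g" using p by (rule gen2E)
  have "coeff (by_degree (u * f)) d \<in> gen2 f g" "coeff (by_degree (v * g)) d \<in> gen2 f g"
    by (simp_all only: coeff_by_degree_mult_homogeneous[OF f] coeff_by_degree_mult_homogeneous[OF g])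
       (auto intro: gen2_mult_left)
  then show ?thesis by (simp only: p by_degree_simps coeff_add gen2_add)
qed

lemma gen2_constant_term:
  assumes "by_degree f = monom f a" "by_degree g = monom g b" "a > 0" "b > 0" "p \<in> gen2 f g"
  shows "restrict_vars {} p = 0"
proof -
  obtain u v where p: "p = u * f + v * g" using assms(5) by (rule gen2E)
  have "coeff (by_degree (u * f)) 0 = 0" "coeff (by_degree (v * g)) 0 = 0"
    using assms(3,4) by (simp_all only: coeff_by_degree_mult_homogeneous[OF assms(1)]
        coeff_by_degree_mult_homogeneous[OF assms(2)]) auto
  then show ?thesis by (simp only: p by_degree_simps coeff_add add_0 flip: coeff_by_degree_0)
qed

text \<open>Induction on the degree of components. In each summand of the component of
  \<open>\<tau> * \<tau>\<close> in degree \<open>d\<close>, one factor is the zero constant term or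
  a component of smaller degree. So this component lies in the ideal, and with it that of
  \<tau>.\<close>

lemma idempotent_gen2_aux:
  assumes hom: "by_degree f = monom f a" "by_degree g = monom g b"
    and \<tau>: "\<tau> * \<tau> - \<tau> \<in> gen2 f g" and 0: "restrict_vars {} \<tau> = 0"
  shows "\<tau> \<in> gen2 f g"
proof -
  have comp: "coeff (by_degree \<tau>) d \<in> gen2 f g" for d
  proof (induction d rule: less_induct)
    case (less d)
    have "coeff (by_degree \<tau>) i * coeff (by_degree \<tau>) (d - i) \<in> gen2 f g" if "i \<le> d" for i
    proof (cases "i = d")
      case True
      then show ?thesis using 0 by (simp add: coeff_by_degree_0)
    next
      case False
      then show ?thesis using that by (intro gen2_mult_right less) auto
    qed
    then have "coeff (by_degree (\<tau> * \<tau>)) d \<in> gen2 f g"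
      by (auto simp: coeff_mult intro: gen2.ideal_sum)
    moreover have "coeff (by_degree (\<tau> * \<tau> - \<tau>)) d \<in> gen2 f g" by (rule components_gen2[OF hom \<tau>])
    ultimately have "coeff (by_degree (\<tau> * \<tau>)) d - coeff (by_degree (\<tau> * \<tau> - \<tau>)) d \<in> gen2 f g"
      by (rule gen2_diff)
    then show ?case by simp
  qed
  have "(\<Sum>e<Suc (degree (by_degree \<tau>)). coeff (by_degree \<tau>) e) = \<tau>"
    by (rule sum_components) (simp add: coeff_eq_0)
  then show ?thesis using gen2.ideal_sum[of "{..<Suc (degree (by_degree \<tau>))}" "coeff (by_degree \<tau>)" f g] comp
    by (simp del: sum.lessThan_Suc)
qed

text \<open>The constant term of \<tau> is an idempotent complex number; if it is 1, pass to
  \<open>1 - \<tau>\<close>.\<close>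

lemma idempotent_gen2:
  assumes hom: "by_degree f = monom f a" "by_degree g = monom g b" and pos: "a > 0" "b > 0"
    and \<tau>: "\<tau> * \<tau> - \<tau> \<in> gen2 f g"
  shows "\<tau> \<in> gen2 f g \<or> 1 - \<tau> \<in> gen2 f g"
proof -
  obtain c where c: "restrict_vars {} \<tau> = mconst c" using restrict_vars_empty by blast
  have minus: "restrict_vars A (p - q) = restrict_vars A p - restrict_vars A q" for A p q
    by (simp add: restrict_vars_def)
  have "mconst (c * c) = mconst c"
    using gen2_constant_term[OF hom pos \<tau>] by (simp add: minus c mconst_mult)
  then have "c * c = c" by (simp only: mconst_eq_iff)
  then have "c = 0 \<or> c = 1" by (simp add: mult_cancel_right2)
  then show ?thesis
  proof
    assume "c = 0"
    then show ?thesis using idempotent_gen2_aux[OF hom \<tau>] c by simp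
  next
    assume "c = 1"
    then have "restrict_vars {} (1 - \<tau>) = 0" by (simp add: minus c)
    moreover have "(1 - \<tau>) * (1 - \<tau>) - (1 - \<tau>) = \<tau> * \<tau> - \<tau>" by (simp add: algebra_simps)
    then have "(1 - \<tau>) * (1 - \<tau>) - (1 - \<tau>) \<in> gen2 f g" using \<tau> by (simp only:)
    ultimately show ?thesis using idempotent_gen2_aux[OF hom] by blast
  qed
qed

lemma free2_finite_vars:
  assumes "\<beta> \<in> free2 i j"
  shows "\<exists>W. finite W \<and> restrict_vars W \<beta> = \<beta> \<and> i \<notin> W \<and> j \<notin> W"
proof -
  obtain W where W: "finite W" "restrict_vars W \<beta> = \<beta>" using finite_vars by blast
  have "restrict_vars (- {i} \<inter> (- {j} \<inter> W)) \<beta> = restrict_vars (- {i}) (restrict_vars (- {j}) (restrict_vars W \<beta>))"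
    by (simp only: restrict_vars_restrict_vars Int_assoc)
  also have "\<dots> = \<beta>" using W assms by (simp add: free2_def flip: drop_var_eq_restrict_vars)
  finally show ?thesis using W(1) by (intro exI[of _ "- {i} \<inter> (- {j} \<inter> W)"]) auto
qed

section \<open>Idempotent fractions\<close>

context power_sum_pair
begin

abbreviation "reg V \<equiv> gen2.regular (power_sum V a) (power_sum V b)"
abbreviation "nilp V \<equiv> gen2.nilpotent (power_sum V a) (power_sum V b)"

lemma one_not_in_I: "1 \<notin> I V"
  using gen2_constant_term[OF by_degree_power_sum by_degree_power_sum a_pos b_pos, of 1 V V] by auto

lemma lift_drop_var:
  assumes "finite V" "drop_var t h \<in> I (V - {t})"
  shows "\<exists>q. h - var t * q \<in> I V"
proof -
  obtain u v where uv: "drop_var t h = u * power_sum (V - {t}) a + v * power_sum (V - {t}) b"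
    using assms(2) by (rule gen2E)
  define k where "k = h - (u * power_sum V a + v * power_sum V b)"
  have "drop_var t k = drop_var t h - drop_var t (drop_var t h)"
    unfolding uv using assms(1)
    by (simp add: k_def uv drop_var_power_sum a_pos b_pos)
  then have "drop_var t k = 0" by (simp add: drop_var_idem)
  then obtain q where "k = var t * q" by (auto simp: drop_var_eq_0_iff elim: dvdE)
  then have "h - var t * q = u * power_sum V a + v * power_sum V b" by (simp add: k_def algebra_simps)
  then show ?thesis by (metis gen2I)
qed

context
  fixes V :: "nat set" and z w :: nat
  assumes V: "finite V" "card V \<ge> 4" "z \<in> V" "w \<in> V" "z \<noteq> w"
begin

lemma reg_var: "reg V (var s)"
proof -
  have "card (V - {s}) \<ge> 2" using V by (cases "s \<in> V") (simp_all add: card_Diff_singleton)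
  then show ?thesis unfolding gen2.regular_def using var_regular[OF V(1)] by blast
qed

text \<open>Regularity of \<open>var w\<close> modulo \<open>I V\<close> and
  \<open>var z ^ M\<close>. With \<open>var z\<close> set to zero it is regularity modulo
  \<open>I (V - {z})\<close>; the remaining factors \<open>var z\<close> are cancelled one at a
  time.\<close>

lemma reg_var_mod_var:
  assumes "var w * h - var z ^ M * q \<in> I V"
  shows "\<exists>q'. h - var z ^ M * q' \<in> I V"
  using assms
proof (induction M arbitrary: h)
  case 0
  show ?case by (intro exI[of _ h]) simp
next
  case (Suc M)
  have card: "card (V - {z} - {w}) \<ge> 2" using V by (simp add: card_Diff_singleton)
  have "drop_var z (var w * h - var z ^ Suc M * q) \<in> I (V - {z})" by (intro I_drop_var V Suc.prems)
  then have "var w * drop_var z h \<in> I (V - {z})" using V by (simp add: drop_var_var)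
  then have "drop_var z h \<in> I (V - {z})" by (rule var_regular[OF finite_Diff[OF V(1)] card])
  then obtain h' where h': "h - var z * h' \<in> I V" using lift_drop_var V by blast
  have "var w * h - var z ^ Suc M * q - var w * (h - var z * h') \<in> I V"
    by (rule gen2_diff[OF Suc.prems gen2_mult_left[OF h']])
  then have "var z * (var w * h' - var z ^ M * q) \<in> I V" by (simp add: algebra_simps)
  then have "var w * h' - var z ^ M * q \<in> I V" using reg_var unfolding gen2.regular_def by blast
  then obtain q' where "h' - var z ^ M * q' \<in> I V" using Suc.IH by blast
  then have "(h - var z * h') + var z * (h' - var z ^ M * q') \<in> I V" by (rule gen2_add[OF h' gen2_mult_left])
  then show ?case by (intro exI[of _ q']) (simp add: algebra_simps)
qed

lemma reg_var_powers:
  assumes "var w ^ N * h - var z ^ M * q \<in> I V"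
  shows "\<exists>q'. h - var z ^ M * q' \<in> I V"
  using assms
proof (induction N arbitrary: q)
  case 0
  then show ?case by auto
next
  case (Suc N)
  then have "var w * (var w ^ N * h) - var z ^ M * q \<in> I V" by (simp add: mult.assoc)
  then show ?case using reg_var_mod_var Suc.IH by blast
qed

end

lemma free2_regular:
  assumes "finite V" "i \<in> V" "j \<in> V" "i \<noteq> j" "\<beta> \<in> free2 i j" "\<beta> \<noteq> 0"
  shows "reg V \<beta>"
proof -
  obtain W where W: "finite W" "restrict_vars W \<beta> = \<beta>" "i \<notin> W" "j \<notin> W"
    using free2_finite_vars[OF assms(5)] by blast
  show ?thesis
    unfolding gen2.regular_def using free_regular[OF W assms(6,1-4)] by blast
qed

text \<open>Take an annihilating polynomial of \<beta> of least degree. Its constant term is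
  nonzero, as otherwise the regular \<beta> could be cancelled, and modulo \<open>I V\<close> it is
  a multiple of \<beta>.\<close>

lemma regular_dvd_free2:
  assumes "finite V" "i \<in> V" "j \<in> V" "i \<noteq> j" and reg: "reg V \<beta>"
  shows "\<exists>\<gamma>\<in>free2 i j. \<gamma> \<noteq> 0 \<and> (\<exists>q. \<gamma> - \<beta> * q \<in> I V)"
proof -
  define P where "P g \<longleftrightarrow> g \<in> free2.polys i j \<and> g \<noteq> 0 \<and> poly g \<beta> \<in> I V" for g
  have "\<exists>g. P g" using algebraic[OF assms(1-4), of \<beta>] by (auto simp: P_def)
  then obtain g where g: "P g" and minimal: "\<And>h. P h \<Longrightarrow> degree g \<le> degree h"
    using ex_has_least_nat[of P _ degree] by metis
  obtain \<gamma> g' where eq: "g = pCons \<gamma> g'" by (cases g)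
  have g': "\<gamma> \<in> free2 i j" "g' \<in> free2.polys i j"
  proof -
    have "coeff g k \<in> free2 i j" for k using g by (auto simp: P_def free2.polys_def)
    from this[of 0] this[of "Suc _"] show "\<gamma> \<in> free2 i j" "g' \<in> free2.polys i j"
      by (auto simp: eq free2.polys_def)
  qed
  have "\<gamma> \<noteq> 0"
  proof
    assume "\<gamma> = 0"
    then have "g' \<noteq> 0" "\<beta> * poly g' \<beta> \<in> I V" using g by (auto simp: P_def eq)
    then have "P g'" using g' reg unfolding P_def gen2.regular_def by blast
    then show False using minimal[of g'] \<open>g' \<noteq> 0\<close> by (simp add: eq)
  qed
  moreover have "\<gamma> - \<beta> * (- poly g' \<beta>) \<in> I V" using g by (simp add: P_def eq)
  ultimately show ?thesis using g'(1) by blast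
qed

text \<open>The fraction \<open>\<alpha> / \<beta>\<close> is idempotent, and \<open>T\<close> is
  its ideal of denominators. As \<open>T\<close> contains powers of two variables, the fraction is
  represented by a polynomial \<tau>, and an idempotent polynomial class is 0 or 1.\<close>

lemma square_eq_mult:
  assumes V: "finite V" "card V = 4" and reg: "reg V \<beta>" and \<alpha>: "\<alpha> * \<alpha> - \<alpha> * \<beta> \<in> I V"
  shows "\<alpha> \<in> I V \<or> \<alpha> - \<beta> \<in> I V"
proof -
  define T where "T = {\<gamma>. \<exists>\<rho>. \<gamma> * \<alpha> - \<beta> * \<rho> \<in> I V}"
  have T: "ring_ideal T"
  proof
    show "0 \<in> T" unfolding T_def by (intro CollectI exI[of _ 0]) simp
  next
    fix p q assume "p \<in> T" "q \<in> T"
    then obtain r s where "p * \<alpha> - \<beta> * r \<in> I V" "q * \<alpha> - \<beta> * s \<in> I V" by (auto simp: T_def)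
    then have "(p * \<alpha> - \<beta> * r) + (q * \<alpha> - \<beta> * s) \<in> I V" by (rule gen2_add)
    then show "p + q \<in> T" unfolding T_def by (intro CollectI exI[of _ "r + s"]) (simp add: algebra_simps)
  next
    fix p q assume "q \<in> T"
    then obtain r where "q * \<alpha> - \<beta> * r \<in> I V" by (auto simp: T_def)
    then have "p * (q * \<alpha> - \<beta> * r) \<in> I V" by (rule gen2_mult_left)
    then show "p * q \<in> T" unfolding T_def by (intro CollectI exI[of _ "p * r"]) (simp add: algebra_simps)
  qed
  have sub: "I V \<subseteq> T"
    unfolding T_def by (intro subsetI CollectI exI[of _ 0]) (simp add: gen2_mult_right)
  \<comment> \<open>Modulo \<open>I V\<close>, \<beta> divides a nonzero element of the base ring,
    which therefore lies in \<open>T\<close>. The derivations turn it into a power of the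
    minor.\<close>
  have minors: "\<exists>N. pminor V i j ^ N \<in> T" if ij: "i \<in> V" "j \<in> V" "i \<noteq> j" for i j
  proof -
    obtain \<gamma> q where \<gamma>: "\<gamma> \<in> free2 i j" "\<gamma> \<noteq> 0" "\<gamma> - \<beta> * q \<in> I V"
      using regular_dvd_free2[OF V(1) ij reg] by blast
    have "(\<gamma> - \<beta> * q) * \<alpha> \<in> I V" by (rule gen2_mult_right[OF \<gamma>(3)])
    then have "\<gamma> * \<alpha> - \<beta> * (q * \<alpha>) \<in> I V" by (simp add: algebra_simps)
    then have "\<gamma> * pminor V i j ^ 0 \<in> T" by (auto simp: T_def)
    moreover obtain W where "finite W" "restrict_vars W \<gamma> = \<gamma>" "i \<notin> W" "j \<notin> W"
      using free2_finite_vars[OF \<gamma>(1)] by blast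
    moreover have "jacobian (power_sum V a) (power_sum V b) i j k \<eta> \<in> T" if \<eta>: "\<eta> \<in> T" for k \<eta>
    proof -
      obtain \<rho> where \<rho>: "\<eta> * \<alpha> - \<beta> * \<rho> \<in> I V" using \<eta> unfolding T_def by blast
      show ?thesis unfolding T_def
        using gen2.transporter_derivation[where D = "jacobian (power_sum V a) (power_sum V b) i j k",
            OF jacobian_diff jacobian_mult jacobian_gen2 reg \<alpha> \<rho>] by blast
    qed
    ultimately show ?thesis using minor_power_mem[OF T] \<gamma>(2) by blast
  qed
  have "V \<noteq> {}" using V by auto
  then obtain z where z: "z \<in> V" by blast
  then have "card (V - {z}) = 3" using V by (simp add: card_Diff_singleton)
  then have "V - {z} \<noteq> {}" by (metis card.empty zero_neq_numeral)
  then obtain w where w: "w \<in> V" "z \<noteq> w" by blast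
  have V4: "card V \<ge> 4" using V(2) by simp
  have pow: "\<exists>N. var s ^ N \<in> T" if "s \<in> V" for s
    using var_power_mem[OF T sub V(1) _ that minors] V(2) by simp
  obtain M N where "var z ^ M \<in> T" "var w ^ N \<in> T" using pow z w by blast
  then obtain \<rho> \<sigma> where \<rho>: "var z ^ M * \<alpha> - \<beta> * \<rho> \<in> I V" and \<sigma>: "var w ^ N * \<alpha> - \<beta> * \<sigma> \<in> I V"
    by (auto simp: T_def)
  \<comment> \<open>The two ways of writing the fraction, with denominators \<open>var z ^ M\<close>
    and \<open>var w ^ N\<close>, agree. Regularity of \<open>var w\<close> modulo
    \<open>var z ^ M\<close> then makes \<rho> divisible by \<open>var z ^ M\<close> modulo
    \<open>I V\<close>.\<close>
  have "var z ^ M * (var w ^ N * \<alpha> - \<beta> * \<sigma>) - var w ^ N * (var z ^ M * \<alpha> - \<beta> * \<rho>) \<in> I V"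
    by (rule gen2_diff[OF gen2_mult_left[OF \<sigma>] gen2_mult_left[OF \<rho>]])
  then have "\<beta> * (var w ^ N * \<rho> - var z ^ M * \<sigma>) \<in> I V" by (simp add: algebra_simps)
  then have "var w ^ N * \<rho> - var z ^ M * \<sigma> \<in> I V" using reg unfolding gen2.regular_def by blast
  then obtain \<tau> where \<tau>: "\<rho> - var z ^ M * \<tau> \<in> I V"
    using reg_var_powers[OF V(1) V4 z w] by blast
  have "(var z ^ M * \<alpha> - \<beta> * \<rho>) + \<beta> * (\<rho> - var z ^ M * \<tau>) \<in> I V"
    by (rule gen2_add[OF \<rho> gen2_mult_left[OF \<tau>]])
  then have "var z ^ M * (\<alpha> - \<beta> * \<tau>) \<in> I V" by (simp add: algebra_simps)
  moreover have "reg V (var z ^ M)" by (rule gen2.regular_power[OF reg_var[OF V(1) V4 z w]])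
  ultimately have \<alpha>\<tau>: "\<alpha> - \<beta> * \<tau> \<in> I V" unfolding gen2.regular_def by blast
  have "(\<alpha> * \<alpha> - \<alpha> * \<beta>) - (\<alpha> + \<beta> * \<tau> - \<beta>) * (\<alpha> - \<beta> * \<tau>) \<in> I V"
    by (rule gen2_diff[OF \<alpha> gen2_mult_left[OF \<alpha>\<tau>]])
  then have "\<beta> * (\<beta> * (\<tau> * \<tau> - \<tau>)) \<in> I V" by (simp add: algebra_simps)
  then have "\<tau> * \<tau> - \<tau> \<in> I V" using reg unfolding gen2.regular_def by blast
  then have "\<tau> \<in> I V \<or> 1 - \<tau> \<in> I V"
    by (intro idempotent_gen2[OF by_degree_power_sum by_degree_power_sum a_pos b_pos])
  then show ?thesis
  proof
    assume "\<tau> \<in> I V"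
    then have "(\<alpha> - \<beta> * \<tau>) + \<beta> * \<tau> \<in> I V" by (intro gen2_add \<alpha>\<tau> gen2_mult_left)
    then show ?thesis by simp
  next
    assume "1 - \<tau> \<in> I V"
    then have "(\<alpha> - \<beta> * \<tau>) - \<beta> * (1 - \<tau>) \<in> I V" by (rule gen2_diff[OF \<alpha>\<tau> gen2_mult_left])
    then show ?thesis by (simp add: algebra_simps)
  qed
qed

end

lemma (in subring) polys_strip_root_0:
  assumes "g \<in> polys" "g \<noteq> 0"
  shows "\<exists>k \<gamma> g'. g = monom 1 k * pCons \<gamma> g' \<and> \<gamma> \<noteq> 0 \<and> \<gamma> \<in> R"
  using assms
proof (induction g)
  case 0
  then show ?case by simp
next
  case (pCons c g)
  show ?case
  proof (cases "c = 0")
    case True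
    have "coeff (pCons c g) (Suc k) \<in> R" for k using pCons.prems(1) unfolding polys_def by blast
    then have "g \<in> polys" by (simp add: polys_def)
    moreover have "g \<noteq> 0" using True pCons.prems(2) by auto
    ultimately obtain k \<gamma> g' where "g = monom 1 k * pCons \<gamma> g'" "\<gamma> \<noteq> 0" "\<gamma> \<in> R"
      using pCons.IH by blast
    then show ?thesis using True
      by (intro exI[of _ "Suc k"] exI[of _ \<gamma>] exI[of _ g']) (simp add: monom_Suc)
  next
    case False
    have "coeff (pCons c g) 0 \<in> R" using pCons.prems(1) unfolding polys_def by blast
    then show ?thesis using False by (intro exI[of _ 0] exI[of _ c] exI[of _ g]) simp
  qed
qed

context power_sum_pair
begin

text \<open>An algebraic equation for \<open>h\<close> takes the form
  \<open>h ^ k * (\<gamma> - y) = 0\<close> modulo \<open>I V\<close>, with \<gamma> regular and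
  \<open>y\<close> a multiple of \<open>h\<close>. Hence \<open>y ^ l / \<gamma> ^ l\<close> is
  idempotent: the value 0 makes \<open>h\<close> nilpotent, the value 1 makes it regular.\<close>

lemma nilpotent_or_regular:
  assumes V: "finite V" "card V = 4" and ij: "i \<in> V" "j \<in> V" "i \<noteq> j"
  shows "nilp V h \<or> reg V h"
proof -
  obtain g where g: "g \<in> free2.polys i j" "g \<noteq> 0" "poly g h \<in> I V"
    using algebraic[OF V(1) ij] by blast
  obtain k \<gamma> g' where eq: "g = monom 1 k * pCons \<gamma> g'" and \<gamma>: "\<gamma> \<noteq> 0" "\<gamma> \<in> free2 i j"
    using free2.polys_strip_root_0[OF g(1,2)] by blast
  \<comment> \<open>One more than \<open>k\<close>, so that \<open>h\<close> divides
    \<open>h ^ l\<close> even when \<open>k = 0\<close>.\<close>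
  define l where "l = Suc k"
  define y where "y = - (h * poly g' h)"
  have "h ^ k * (\<gamma> - y) \<in> I V" using g(3) by (simp add: eq poly_monom y_def algebra_simps)
  then have "h * (h ^ k * (\<gamma> - y)) \<in> I V" by (rule gen2_mult_left)
  then have hl: "h ^ l * (\<gamma> - y) \<in> I V" by (simp add: l_def mult.assoc)
  have hl': "h ^ l * (\<gamma> ^ l - y ^ l) \<in> I V"
    using hl by (rule gen2_dvd) (intro mult_dvd_mono dvd_refl diff_dvd_power_diff)
  have reg: "reg V (\<gamma> ^ l)" using free2_regular[OF V(1) ij \<gamma>(2,1)] by (rule gen2.regular_power)
  obtain r where r: "y ^ l = h ^ l * r" by (metis y_def power_mult_distrib mult_minus_right)
  have "y ^ l * y ^ l - y ^ l * \<gamma> ^ l = - r * (h ^ l * (\<gamma> ^ l - y ^ l))"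
    by (simp add: r algebra_simps)
  then have "y ^ l * y ^ l - y ^ l * \<gamma> ^ l \<in> I V" using gen2_mult_left[OF hl', of "- r"] by simp
  from square_eq_mult[OF V reg this] show ?thesis
  proof
    assume "y ^ l \<in> I V"
    then have "h ^ l * (\<gamma> ^ l - y ^ l) + h ^ l * y ^ l \<in> I V" by (intro gen2_add hl' gen2_mult_left)
    then have "\<gamma> ^ l * h ^ l \<in> I V" by (simp add: algebra_simps)
    then have "h ^ l \<in> I V" using reg unfolding gen2.regular_def by blast
    then show ?thesis unfolding gen2.nilpotent_def by blast
  next
    assume "y ^ l - \<gamma> ^ l \<in> I V"
    then have "reg V (y ^ l)" using reg gen2.regular_cong by blast
    then have "reg V (h * (h ^ k * r))" by (simp only: r) (simp only: l_def power_Suc mult.assoc)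
    then show ?thesis using gen2.regular_factor by blast
  qed
qed

text \<open>The whole ring arises from the base ring by adjoining \<open>var i\<close> and then
  \<open>var j\<close>, each a simple root of the elimination polynomial modulo \<open>I V\<close>.
  So every element is zero or regular modulo \<open>I V\<close>.\<close>

lemma prime_I_4:
  assumes V: "finite V" "card V = 4"
  shows "prime_I V"
proof -
  have "V \<noteq> {}" using V by auto
  then obtain i where i: "i \<in> V" by blast
  then have "card (V - {i}) = 3" using V by (simp add: card_Diff_singleton)
  then have "V - {i} \<noteq> {}" by (metis card.empty zero_neq_numeral)
  then obtain j where j: "j \<in> V" "i \<noteq> j" by blast
  note primary = nilpotent_or_regular[OF V i j]
  have V4: "card V \<ge> 4" using V by simp
  have regular_deriv: "reg V (poly (pderiv (elim_poly (V - {i, j}))) (var i))"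
    if ij: "i \<in> V" "j \<in> V" "i \<noteq> j" for i j
  proof -
    note rv = reg_var[OF V(1) V4 ij]
    \<comment> \<open>If this difference were nilpotent, setting \<open>var j\<close> to zero would
      put a power of \<open>var i\<close> into \<open>I (V - {j})\<close>, where
      \<open>var i\<close> is regular.\<close>
    have diff: "reg V (var i ^ (b - a) - var j ^ (b - a))"
    proof (rule ccontr)
      assume "\<not> ?thesis"
      then have "nilp V (var i ^ (b - a) - var j ^ (b - a))" using primary by blast
      then obtain k where "(var i ^ (b - a) - var j ^ (b - a)) ^ k \<in> I V"
        unfolding gen2.nilpotent_def by blast
      then have "drop_var j ((var i ^ (b - a) - var j ^ (b - a)) ^ k) \<in> I (V - {j})"
        by (rule I_drop_var[OF V(1)])
      then have "(var i ^ (b - a)) ^ k * 1 \<in> I (V - {j})"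
        using ij a_less_b by (simp add: drop_var_var power_0_left)
      moreover have "card (V - {j} - {i}) \<ge> 2" using V ij by (simp add: card_Diff_singleton)
      then have "reg (V - {j}) (var i)"
        unfolding gen2.regular_def using var_regular[of "V - {j}" i] V(1) by blast
      then have "reg (V - {j}) ((var i ^ (b - a)) ^ k)" by (intro gen2.regular_power)
      ultimately have "1 \<in> I (V - {j})" unfolding gen2.regular_def by blast
      then show False using one_not_in_I by blast
    qed
    have "of_nat (a * b) \<in> free2 i j" unfolding mconst_of_nat[symmetric] by (rule mconst_free2)
    moreover have "(of_nat (a * b) :: mpoly) \<noteq> 0" using a_pos b_pos by simp
    ultimately have "reg V (of_nat (a * b))" using free2_regular[OF V(1) ij] by blast
    then have "reg V (of_nat (a * b) * (var i ^ (a - 1) * var j ^ (a * b - b) * (var i ^ (b - a) - var j ^ (b - a))))"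
      by (intro gen2.regular_mult gen2.regular_power rv diff)
    then show ?thesis using gen2.regular_cong[OF elim_poly_deriv[OF V(1) ij]] by blast
  qed
  let ?m = "elim_poly (V - {i, j})"
  have m: "?m \<in> free2.polys i j" by (intro elim_poly_free2) auto
  interpret B: primary_ideal_over "I V" "free2 i j"
  proof
    show "r \<in> I V \<or> reg V r" if "r \<in> free2 i j" for r
      using free2_regular[OF V(1) i j that] by (cases "r = 0") auto
  qed (use one_not_in_I primary in auto)
  define R where "R = (\<lambda>p. poly p (var i)) ` free2.polys i j"
  interpret R: subring R unfolding R_def by (rule free2.subring_adjoin)
  \<comment> \<open>The first adjunction makes \<open>R\<close> a base of the same kind, over which
    the second is performed.\<close>
  interpret R: primary_ideal_over "I V" R
  proof
    show "r \<in> I V \<or> reg V r" if "r \<in> R" for r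
      using that B.adjoin_simple_root[OF m elim_poly_root[OF V(1) i j] regular_deriv[OF i j]]
      by (auto simp: R_def)
  qed (use one_not_in_I primary in auto)
  have free2_R: "\<beta> \<in> R" if "\<beta> \<in> free2 i j" for \<beta>
    unfolding R_def using that
    by (intro image_eqI[of _ _ "[:\<beta>:]"]) (auto simp: free2.polys_def coeff_pCons split: nat.splits)
  have mR: "?m \<in> R.polys" using m free2_R by (auto simp: R.polys_def free2.polys_def)
  have ji: "V - {j, i} = V - {i, j}" by auto
  have generated: "p \<in> (\<lambda>p. poly p (var j)) ` R.polys" for p
  proof -
    interpret S: subring "(\<lambda>p. poly p (var j)) ` R.polys" by (rule R.subring_adjoin)
    have base: "r \<in> (\<lambda>p. poly p (var j)) ` R.polys" if "r \<in> R" for r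
      using that by (intro image_eqI[of _ _ "[:r:]"]) (auto simp: R.polys_def coeff_pCons split: nat.splits)
    show ?thesis
    proof (induction p rule: mpoly_induct)
      case (const c)
      show ?case by (intro base free2_R mconst_free2)
    next
      case (var s)
      show ?case
      proof (cases "s = j")
        case True
        then show ?thesis
          by (intro image_eqI[of _ _ "[:0, 1:]"]) (auto simp: R.polys_def coeff_pCons split: nat.splits)
      next
        case False
        have "var s \<in> R"
        proof (cases "s = i")
          case True
          then show ?thesis unfolding R_def
            by (intro image_eqI[of _ _ "[:0, 1:]"]) (auto simp: free2.polys_def coeff_pCons split: nat.splits)
        next
          case ne: False
          then show ?thesis using False by (intro free2_R var_free2)
        qed
        then show ?thesis by (rule base)
      qed
    qed (auto intro: S.add_mem S.mult_mem)
  qed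
  have mj: "poly ?m (var j) \<in> I V" "reg V (poly (pderiv ?m) (var j))"
    using elim_poly_root[OF V(1) j(1) i j(2)[symmetric]] regular_deriv[OF j(1) i j(2)[symmetric]]
    by (simp_all add: ji)
  have "p \<in> I V \<or> reg V p" for p
  proof -
    obtain r where r: "r \<in> R.polys" "p = poly r (var j)" using generated[of p] by blast
    show ?thesis unfolding r(2) by (rule R.adjoin_simple_root[OF mR mj r(1)])
  qed
  then show ?thesis unfolding prime_I_def gen2.regular_def by blast
qed

lemma prime_I:
  assumes "finite V" "card V \<ge> 4"
  shows "prime_I V"
  using assms
proof (induction "card V" arbitrary: V rule: less_induct)
  case less
  show ?case
  proof (cases "card V = 4")
    case True
    then show ?thesis using prime_I_4 less.prems by blast
  next
    case False
    have "V \<noteq> {}" using less.prems by auto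
    then obtain t where t: "t \<in> V" by blast
    have c: "card (V - {t}) \<ge> 4" "card (V - {t}) < card V"
      using False less.prems t by (simp_all add: card_Diff_singleton)
    then have "prime_I (V - {t})" using less.hyps less.prems(1) by simp
    then show ?thesis using prime_I_remove[of V t] less.prems(1) c by simp
  qed
qed

end

section \<open>The polynomial ring in finitely many variables\<close>

lemma polyring_iff: "p \<in> polyring n \<longleftrightarrow> restrict_vars {..<n} p = p"
proof
  assume p: "p \<in> polyring n"
  have "into_mpoly.monom_val (\<lambda>i. if i \<in> {..<n} then var i else 0) m =
      (\<Prod>i\<in>Poly_Mapping.keys m. var i ^ Poly_Mapping.lookup m i)" if "m \<in> Poly_Mapping.keys p" for m
    unfolding into_mpoly.monom_val_def
    using p that by (intro prod.cong) (auto simp: polyring_def)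
  then have "restrict_vars {..<n} p = (\<Sum>m\<in>Poly_Mapping.keys p. Poly_Mapping.single m (Poly_Mapping.lookup p m))"
    unfolding restrict_vars_def into_mpoly.ev_def single_eq_mconst_times_vars
    by (intro sum.cong) auto
  then show "restrict_vars {..<n} p = p" by (simp add: poly_mapping_sum_singles)
next
  have "restrict_vars {..<n} p \<in> polyring n"
  proof (induction p rule: mpoly_induct)
    case (const c)
    show ?case unfolding restrict_vars_simps by (simp add: polyring_def mconst_def)
  next
    case (var i)
    show ?case unfolding restrict_vars_simps by (auto simp: polyring_def var_def)
  next
    case (add p q)
    then show ?case using keys_add[of "restrict_vars {..<n} p" "restrict_vars {..<n} q"]
      by (auto simp: polyring_def)
  next
    case (mult p q)
    show ?case unfolding polyring_def restrict_vars_simps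
    proof (intro CollectI ballI)
      fix m assume "m \<in> Poly_Mapping.keys (restrict_vars {..<n} p * restrict_vars {..<n} q)"
      then obtain k l where kl: "m = k + l" "k \<in> Poly_Mapping.keys (restrict_vars {..<n} p)"
          "l \<in> Poly_Mapping.keys (restrict_vars {..<n} q)"
        using keys_mult[of "restrict_vars {..<n} p" "restrict_vars {..<n} q"] by blast
      have "Poly_Mapping.keys m \<subseteq> Poly_Mapping.keys k \<union> Poly_Mapping.keys l"
        unfolding kl(1) by (rule keys_add)
      then show "Poly_Mapping.keys m \<subseteq> {..<n}" using kl mult by (auto simp: polyring_def)
    qed
  qed
  then show "restrict_vars {..<n} p = p \<Longrightarrow> p \<in> polyring n" by simp
qed

lemma psum_eq_power_sum: "psum n d = power_sum {..<n} d"
  by (simp add: psum_def power_sum_def)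

lemma power_sum_polyring: "power_sum {..<n} d \<in> polyring n"
  by (simp add: polyring_iff power_sum_def)

lemma gen_ideal_Nil: "gen_ideal n [] = {0}"
  by (simp add: gen_ideal_def)

lemma gen_ideal_one:
  assumes "f \<in> polyring n"
  shows "gen_ideal n [f] = {h \<in> polyring n. f dvd h}"
proof (intro set_eqI iffI)
  fix h assume "h \<in> gen_ideal n [f]"
  then show "h \<in> {h \<in> polyring n. f dvd h}"
    using assms by (auto simp: gen_ideal_def polyring_iff)
next
  fix h assume h: "h \<in> {h \<in> polyring n. f dvd h}"
  then obtain u where "h = f * u" by (auto elim: dvdE)
  then have "h = restrict_vars {..<n} u * f"
    using h assms by (metis (mono_tags, lifting) mem_Collect_eq mult.commute polyring_iff restrict_vars_simps(5))
  moreover have "restrict_vars {..<n} u \<in> polyring n"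
    by (simp add: polyring_iff restrict_vars_restrict_vars)
  ultimately show "h \<in> gen_ideal n [f]" unfolding gen_ideal_def
    by (intro CollectI exI[of _ "\<lambda>_. restrict_vars {..<n} u"]) simp
qed

text \<open>Setting all further variables to zero fixes \<open>f\<close>, \<open>g\<close> and
  \<open>h\<close> and moves the cofactors into \<open>polyring n\<close>.\<close>

lemma gen_ideal_two:
  assumes "f \<in> polyring n" "g \<in> polyring n"
  shows "gen_ideal n [f, g] = gen2 f g \<inter> polyring n"
proof (intro set_eqI iffI)
  fix h assume "h \<in> gen_ideal n [f, g]"
  then obtain r :: "nat \<Rightarrow> mpoly" where r: "\<forall>i<2. r i \<in> polyring n" "h = r 0 * f + r 1 * g"
    by (auto simp: gen_ideal_def numeral_2_eq_2)
  then have "h \<in> gen2 f g" by (metis gen2I)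
  moreover have "r 0 \<in> polyring n" "r 1 \<in> polyring n" using r(1) by auto
  then have "h \<in> polyring n" using assms by (simp add: r(2) polyring_iff)
  ultimately show "h \<in> gen2 f g \<inter> polyring n" by blast
next
  fix h assume h: "h \<in> gen2 f g \<inter> polyring n"
  then obtain u v where "h = u * f + v * g" by (auto elim: gen2E)
  then have "restrict_vars {..<n} h = restrict_vars {..<n} u * f + restrict_vars {..<n} v * g"
    using assms by (simp add: polyring_iff)
  then have eq: "h = restrict_vars {..<n} u * f + restrict_vars {..<n} v * g"
    using h by (simp add: polyring_iff)
  have "restrict_vars {..<n} p \<in> polyring n" for p
    by (simp add: polyring_iff restrict_vars_restrict_vars)
  then show "h \<in> gen_ideal n [f, g]" unfolding gen_ideal_def
    by (intro CollectI exI[of _ "\<lambda>i. if i = 0 then restrict_vars {..<n} u else restrict_vars {..<n} v"])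
       (simp add: lessThan_Suc numeral_2_eq_2 add.commute flip: eq)
qed

lemma restrict_vars_empty_power_sum: "d > 0 \<Longrightarrow> restrict_vars {} (power_sum V d) = 0"
  by (simp add: power_sum_def zero_power)

lemma one_not_in_gen_ideal:
  assumes "\<And>y. y \<in> set ys \<Longrightarrow> restrict_vars {} y = 0"
  shows "1 \<notin> gen_ideal n ys"
proof
  assume "1 \<in> gen_ideal n ys"
  then obtain r where "1 = (\<Sum>i<length ys. r i * ys ! i)" by (auto simp: gen_ideal_def)
  from arg_cong[OF this, of "restrict_vars {}"] assms show False by simp
qed

theorem theorem3p7:
  fixes n a b q1 :: nat
  assumes "n \<ge> 4" and "0 < a" and "a < b"
    and "prime q1" and "q1 dvd (b - a)"
    and "\<forall>q. prime q \<and> q dvd (b - a) \<longrightarrow> q1 \<le> q"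
    and "q1 > max n a"
  shows "prime_ideal_in n (gen_ideal n [psum n a, psum n b])
    \<and> (\<forall>c>0. psum n c \<notin> gen_ideal n [psum n a, psum n b]
          \<longrightarrow> regular_seq n [psum n a, psum n b, psum n c])"
proof -
  \<comment> \<open>The least prime factor of \<open>b - a\<close> exceeds \<open>n\<close>, hence
    4, so neither 2 nor 3 divides \<open>b - a\<close>.\<close>
  have "q1 > 4" using assms by simp
  interpret power_sum_pair a b
  proof
    show "odd (b - a)" using assms(6) \<open>q1 > 4\<close> two_is_prime_nat by fastforce
    have "prime (3::nat)" by simp
    then show "\<not> 3 dvd b - a" using assms(6) \<open>q1 > 4\<close> by fastforce
  qed (use assms in auto)
  let ?V = "{..<n}"
  have V: "finite ?V" "card ?V \<ge> 4" "card ?V \<ge> 2" using assms(1) by simp_all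
  have mem: "psum n d \<in> polyring n" for d by (simp add: psum_eq_power_sum power_sum_polyring)
  have one: "1 \<in> polyring n" by (simp add: polyring_iff)
  have proper: "1 \<notin> gen_ideal n ys" if "set ys \<subseteq> {psum n d | d. d > 0}" for ys
    using that by (intro one_not_in_gen_ideal) (auto simp: psum_eq_power_sum restrict_vars_empty_power_sum)
  have I: "gen_ideal n [psum n a, psum n b] = I ?V \<inter> polyring n"
    unfolding gen_ideal_two[OF mem mem] by (simp add: psum_eq_power_sum)
  have prime: "p \<in> I ?V \<or> q \<in> I ?V" if "p * q \<in> I ?V" for p q
    using prime_I[OF V(1,2)] that by (simp add: prime_I_def)
  have "1 \<notin> gen_ideal n [psum n a, psum n b]"
    using a_pos b_pos by (intro proper) auto
  then have "prime_ideal_in n (gen_ideal n [psum n a, psum n b])"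
    using one prime unfolding prime_ideal_in_def I by blast
  moreover have "regular_seq n [psum n a, psum n b, psum n c]"
    if c: "c > 0" "psum n c \<notin> gen_ideal n [psum n a, psum n b]" for c
    unfolding regular_seq_def
  proof (intro conjI allI impI ballI)
    show "set [psum n a, psum n b, psum n c] \<subseteq> polyring n" using mem by auto
    have "1 \<notin> gen_ideal n [psum n a, psum n b, psum n c]"
      using a_pos b_pos c(1) by (intro proper) auto
    then show "gen_ideal n [psum n a, psum n b, psum n c] \<noteq> polyring n" using one by blast
    fix i z
    assume i: "i < length [psum n a, psum n b, psum n c]" and z: "z \<in> polyring n"
      and prod: "[psum n a, psum n b, psum n c] ! i * z \<in> gen_ideal n (take i [psum n a, psum n b, psum n c])"
    \<comment> \<open>The three positions use, in turn, that the polynomial ring is a domain, that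
      the first two power sums are coprime, and that they generate a prime ideal not containing
      \<open>psum n c\<close>.\<close>
    consider "i = 0" | "i = 1" | "i = 2" using i by fastforce
    then show "z \<in> gen_ideal n (take i [psum n a, psum n b, psum n c])"
    proof cases
      case 1
      have "psum n a \<noteq> 0"
        using power_sum_neq_0[of ?V 0 a] assms(1) a_pos by (simp add: psum_eq_power_sum)
      then show ?thesis using prod 1 by (simp add: gen_ideal_Nil)
    next
      case 2
      have "psum n a dvd z * psum n b"
        using prod 2 by (simp add: gen_ideal_one[OF mem] mult.commute)
      then have "psum n a dvd z"
        using power_sum_coprime[OF V(1,3)] by (simp only: psum_eq_power_sum)
      then show ?thesis using 2 z by (simp add: gen_ideal_one[OF mem])
    next
      case 3
      have "psum n c * z \<in> I ?V" using prod 3 by (simp add: I)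
      moreover have "psum n c \<notin> I ?V" using c(2) mem by (simp add: I)
      ultimately have "z \<in> I ?V" using prime by blast
      then show ?thesis using 3 z by (simp add: I)
    qed
  qed
  ultimately show ?thesis by blast
qed

end
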